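(* Let $A_1,\dots,A_m,C$ be real symmetric $n\times n$ matrices and $b\in\mathbb{R}^m$, let $(\mathcal{P},\mathcal{D})$ be the associated primal-dual pair of semidefinite programs, let $M$ be a solution bound for $(\mathcal{P},\mathcal{D})$, and let $G_M$ be the corresponding modified semidefinite Dantzig game with value $v$. Assume that a strictly unbounded direction exists for $\mathcal{P}$ or for $\mathcal{D}$. Then, for every optimal strategy $\operatorname{diag}(X',y',t',u)$ of the first player in $G_M$, we have $t'=0$ and $u=v$. Furthermore, $X'$ is an unbounded direction for $\mathcal{P}$ (which is a certificate that $\mathcal{D}$ is infeasible) or $y'$ is an unbounded direction for $\mathcal{D}$ (which is a certificate that $\mathcal{P}$ is infeasible).
   Context: $\mathcal{S}_n$ is the space of real symmetric $n\times n$ matrices, $\mathcal{S}_n^+$ the cone of positive semidefinite ones, $\succeq,\preceq,\prec$ the Loewner order, $\langle A,B\rangle=\operatorname{tr}(AB)$, $\mathbf{1}$ the all-ones vector, $[m]=\{1,\dots,m\}$. Primal-dual pair: $\mathcal{P}:\ \inf_X\{\langle C,X\rangle : \langle A_i,X\rangle\ge b_i,\ i\in[m],\ X\in\mathcal{S}_n^+\}$ and $\mathcal{D}:\ \sup_y\{b^Ty : \sum_{i=1}^m y_iA_i\preceq C,\ y\in\mathbb{R}^m_+\}$. Strictly unbounded directions: $W\in\mathcal{S}_n^+$ is a strictly unbounded direction for $\mathcal{P}$ if $\langle A_i,W\rangle>0$ for all $i\in[m]$ and $\langle C,W\rangle<0$. $y\in\mathbb{R}^m_+$ is a strictly unbounded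 direction for $\mathcal{D}$ if $\sum_{i=1}^m y_iA_i\prec 0$ and $b^Ty>0$. Unbounded directions: $W\in\mathcal{S}_n^+$ is an unbounded direction for $\mathcal{P}$ if $\langle A_i,W\rangle\ge0$ for all $i\in[m]$ and $\langle C,W\rangle<0$. $y\in\mathbb{R}^m_+$ is an unbounded direction for $\mathcal{D}$ if $\sum_{i=1}^m y_iA_i\preceq 0$ and $b^Ty>0$. Auxiliary SDP: $\mathcal{P}_{\mathrm{aux}}$ is the problem $\inf w$ subject to $\langle A_i,X\rangle+w\ge b_i$ for $i\in[m]$, $\sum_{i=1}^m y_iA_i-wI_n\preceq C$, $\langle C,X\rangle-b^Ty-w\le 0$, $X\succeq 0$, $y\ge 0$, $w\ge 0$, in the variables $(X,y,w)\in\mathcal{S}_n\times\mathbb{R}^m\times\mathbb{R}$. Solution bound: if the infimum of $\mathcal{P}_{\mathrm{aux}}$ is attained, a solution bound is any $M>0$ such that $\operatorname{tr}(X^* )+\mathbf{1}^Ty^*+1\le M$ holds for some optimal solution $(X^*,y^*,w^* )$ of $\mathcal{P}_{\mathrm{aux}}$; if the infimum is not attained, any $M>0$ is a solution bound. Modified semidefinite Dantzig game $G_M$: a zero-sum game. Strategies of the first player are block-diagonal matrices $\bar X=\operatorname{diag}(X^{(1)},y^{(1)},t^{(1)},u)$ (diagonal blocks $X^{(1)}$, $\operatorname{diag}(y^{(1)})$, $t^{(1)}$, $u$) with $X^{(1)}\in\mathcal{S}_n^+$, $y^{(1)}\in\mathbb{R}^m_+$, $t^{(1)}\ge0$, $u\ge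 0$ and $\operatorname{tr}(\bar X)=1$. Strategies of the second player are block-diagonal matrices $\bar Y=\operatorname{diag}(X^{(2)},y^{(2)},t^{(2)})$ with $X^{(2)}\in\mathcal{S}_n^+$, $y^{(2)}\in\mathbb{R}^m_+$, $t^{(2)}\ge0$ and $\operatorname{tr}(\bar Y)=1$. (The game is formally a semidefinite game on $\mathcal{S}_{n+m+2}\times\mathcal{S}_{n+m+1}$ with payoff tensor vanishing outside these blocks; strategies are identified with their block-diagonal parts.) The payoff to the first player (who maximizes; the second player receives the negative) is $$p(\bar X,\bar Y)=\sum_{i=1}^m y^{(1)}_i\bigl(t^{(2)}b_i-\langle A_i,X^{(2)}\rangle\bigr)+\Bigl\langle X^{(1)},\sum_{i=1}^m y^{(2)}_iA_i-t^{(2)}C\Bigr\rangle+t^{(1)}\bigl(\langle C,X^{(2)}\rangle-b^Ty^{(2)}\bigr)+u\bigl(\operatorname{tr}(X^{(2)})+\mathbf{1}^Ty^{(2)}-t^{(2)}M\bigr).$$ The value is $v=\max_{\bar X}\min_{\bar Y}p(\bar X,\bar Y)=\min_{\bar Y}\max_{\bar X}p(\bar X,\bar Y)$; a strategy of a player is optimal if it attains the corresponding outer optimum, i.e. guarantees that player the value. *)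

theory Defs
  imports "HOL-Analysis.Analysis"
begin

section \<open>Symmetric matrices and the Loewner order\<close>

definition sym_mat :: "real^'n^'n \<Rightarrow> bool"
  where "sym_mat X \<longleftrightarrow> transpose X = X"

definition psd :: "real^'n^'n \<Rightarrow> bool"
  where "psd X \<longleftrightarrow> sym_mat X \<and> (\<forall>z. 0 \<le> z \<bullet> (X *v z))"

definition pd :: "real^'n^'n \<Rightarrow> bool"
  where "pd X \<longleftrightarrow> sym_mat X \<and> (\<forall>z. z \<noteq> 0 \<longrightarrow> 0 < z \<bullet> (X *v z))"

definition loewner_le :: "real^'n^'n \<Rightarrow> real^'n^'n \<Rightarrow> bool" (infix "\<preceq>\<^sub>L" 50)
  where "X \<preceq>\<^sub>L Y \<longleftrightarrow> psd (Y - X)"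

definition loewner_less :: "real^'n^'n \<Rightarrow> real^'n^'n \<Rightarrow> bool" (infix "\<prec>\<^sub>L" 50)
  where "X \<prec>\<^sub>L Y \<longleftrightarrow> pd (Y - X)"

definition trace_inner :: "real^'n^'n \<Rightarrow> real^'n^'n \<Rightarrow> real"
  where "trace_inner X Y = trace (X ** Y)"

definition nonneg_vec :: "real^'m \<Rightarrow> bool"
  where "nonneg_vec y \<longleftrightarrow> (\<forall>i. 0 \<le> y $ i)"


section \<open>The primal-dual pair\<close>

text \<open>The data of the pair is a family \<open>A\<close> of matrices indexed by a finite type \<open>'m\<close>,
  a matrix \<open>C\<close> and a vector \<open>b\<close>.\<close>

definition lin_comb :: "('m::finite \<Rightarrow> real^'n^'n) \<Rightarrow> real^'m \<Rightarrow> real^'n^'n"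
  where "lin_comb A y = (\<Sum>i\<in>UNIV. (y $ i) *\<^sub>R A i)"

definition primal_feasible ::
    "('m::finite \<Rightarrow> real^'n^'n) \<Rightarrow> real^'m \<Rightarrow> real^'n^'n \<Rightarrow> bool"
  where "primal_feasible A b X \<longleftrightarrow> psd X \<and> (\<forall>i. trace_inner (A i) X \<ge> b $ i)"

definition dual_feasible ::
    "('m::finite \<Rightarrow> real^'n^'n) \<Rightarrow> real^'n^'n \<Rightarrow> real^'m \<Rightarrow> bool"
  where "dual_feasible A C y \<longleftrightarrow> nonneg_vec y \<and> lin_comb A y \<preceq>\<^sub>L C"

definition primal_strictly_unbounded_dir ::
    "('m::finite \<Rightarrow> real^'n^'n) \<Rightarrow> real^'n^'n \<Rightarrow> real^'n^'n \<Rightarrow> bool"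
  where "primal_strictly_unbounded_dir A C W \<longleftrightarrow>
    psd W \<and> (\<forall>i. trace_inner (A i) W > 0) \<and> trace_inner C W < 0"

definition dual_strictly_unbounded_dir ::
    "('m::finite \<Rightarrow> real^'n^'n) \<Rightarrow> real^'m \<Rightarrow> real^'m \<Rightarrow> bool"
  where "dual_strictly_unbounded_dir A b y \<longleftrightarrow>
    nonneg_vec y \<and> lin_comb A y \<prec>\<^sub>L 0 \<and> b \<bullet> y > 0"

definition primal_unbounded_dir ::
    "('m::finite \<Rightarrow> real^'n^'n) \<Rightarrow> real^'n^'n \<Rightarrow> real^'n^'n \<Rightarrow> bool"
  where "primal_unbounded_dir A C W \<longleftrightarrow>
    psd W \<and> (\<forall>i. trace_inner (A i) W \<ge> 0) \<and> trace_inner C W < 0"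

definition dual_unbounded_dir ::
    "('m::finite \<Rightarrow> real^'n^'n) \<Rightarrow> real^'m \<Rightarrow> real^'m \<Rightarrow> bool"
  where "dual_unbounded_dir A b y \<longleftrightarrow>
    nonneg_vec y \<and> lin_comb A y \<preceq>\<^sub>L 0 \<and> b \<bullet> y > 0"


section \<open>The auxiliary problem and solution bounds\<close>

definition aux_feasible ::
    "('m::finite \<Rightarrow> real^'n^'n) \<Rightarrow> real^'m \<Rightarrow> real^'n^'n \<Rightarrow>
     real^'n^'n \<Rightarrow> real^'m \<Rightarrow> real \<Rightarrow> bool"
  where "aux_feasible A b C X y w \<longleftrightarrow>
    (\<forall>i. trace_inner (A i) X + w \<ge> b $ i) \<and>
    lin_comb A y - mat w \<preceq>\<^sub>L C \<and>
    trace_inner C X - b \<bullet> y - w \<le> 0 \<and>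
    psd X \<and> nonneg_vec y \<and> w \<ge> 0"

definition aux_optimal ::
    "('m::finite \<Rightarrow> real^'n^'n) \<Rightarrow> real^'m \<Rightarrow> real^'n^'n \<Rightarrow>
     real^'n^'n \<Rightarrow> real^'m \<Rightarrow> real \<Rightarrow> bool"
  where "aux_optimal A b C X y w \<longleftrightarrow>
    aux_feasible A b C X y w \<and>
    (\<forall>X' y' w'. aux_feasible A b C X' y' w' \<longrightarrow> w \<le> w')"

definition solution_bound ::
    "('m::finite \<Rightarrow> real^'n^'n) \<Rightarrow> real^'m \<Rightarrow> real^'n^'n \<Rightarrow> real \<Rightarrow> bool"
  where "solution_bound A b C M \<longleftrightarrow> M > 0 \<and>
    ((\<exists>X y w. aux_optimal A b C X y w) \<longrightarrow>
     (\<exists>X y w. aux_optimal A b C X y w \<and> trace X + (\<Sum>i\<in>UNIV. y $ i) + 1 \<le> M))"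


section \<open>Zero-sum games\<close>

text \<open>A game is given by the strategy sets \<open>S\<close>, \<open>T\<close> of the two players and the payoff \<open>p\<close>
  to the first player. The suprema and infima below are taken in the conditionally complete
  order of the reals; they are meaningful for the game of interest, where both strategy sets are
  nonempty and compact and the payoff is bilinear, so that they are in fact maxima and minima.\<close>

definition guaranteed_payoff :: "'t set \<Rightarrow> ('s \<Rightarrow> 't \<Rightarrow> real) \<Rightarrow> 's \<Rightarrow> real"
  where "guaranteed_payoff T p x = (INF y\<in>T. p x y)"

definition game_value :: "'s set \<Rightarrow> 't set \<Rightarrow> ('s \<Rightarrow> 't \<Rightarrow> real) \<Rightarrow> real"
  where "game_value S T p = (SUP x\<in>S. guaranteed_payoff T p x)"

definition optimal_strategy1 :: "'s set \<Rightarrow> 't set \<Rightarrow> ('s \<Rightarrow> 't \<Rightarrow> real) \<Rightarrow> 's \<Rightarrow> bool"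
  where "optimal_strategy1 S T p x \<longleftrightarrow> x \<in> S \<and> guaranteed_payoff T p x = game_value S T p"


section \<open>The modified semidefinite Dantzig game\<close>

definition dsum :: "real^'a::finite^'a \<Rightarrow> real^'b::finite^'b \<Rightarrow> real^('a + 'b)^('a + 'b)" (infixr "\<oplus>\<^sub>D" 65)
  where "P \<oplus>\<^sub>D Q = (\<chi> r c. case (r, c) of
      (Inl i, Inl j) \<Rightarrow> P $ i $ j
    | (Inr i, Inr j) \<Rightarrow> Q $ i $ j
    | _ \<Rightarrow> 0)"

definition block1 :: "real^('a::finite + 'b::finite)^('a + 'b) \<Rightarrow> real^'a^'a"
  where "block1 Z = (\<chi> i j. Z $ Inl i $ Inl j)"

definition block2 :: "real^('a::finite + 'b::finite)^('a + 'b) \<Rightarrow> real^'b^'b"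
  where "block2 Z = (\<chi> i j. Z $ Inr i $ Inr j)"

definition diag_mat :: "real^'m \<Rightarrow> real^'m^'m"
  where "diag_mat y = (\<chi> i j. if i = j then y $ i else 0)"

definition diag_vec :: "real^'m^'m \<Rightarrow> real^'m"
  where "diag_vec Z = (\<chi> i. Z $ i $ i)"

text \<open>The scalar blocks are the \<open>1 \<times> 1\<close> matrices \<^term>\<open>mat t :: real^1^1\<close>, so that
  strategies have sizes \<open>n + m + 2\<close> and \<open>n + m + 1\<close>.\<close>

type_synonym ('n, 'm) mat1 = "real^('n + 'm + 1 + 1)^('n + 'm + 1 + 1)"
type_synonym ('n, 'm) mat2 = "real^('n + 'm + 1)^('n + 'm + 1)"

definition diag1 :: "real^'n^'n \<Rightarrow> real^'m \<Rightarrow> real \<Rightarrow> real \<Rightarrow> ('n, 'm) mat1"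
  where "diag1 X y t u = X \<oplus>\<^sub>D diag_mat y \<oplus>\<^sub>D mat t \<oplus>\<^sub>D mat u"

definition diag2 :: "real^'n^'n \<Rightarrow> real^'m \<Rightarrow> real \<Rightarrow> ('n, 'm) mat2"
  where "diag2 X y t = X \<oplus>\<^sub>D diag_mat y \<oplus>\<^sub>D mat t"

definition strategies1 :: "('n::finite, 'm::finite) mat1 set"
  where "strategies1 =
    {diag1 X y t u | X y t u. psd X \<and> nonneg_vec y \<and> t \<ge> 0 \<and> u \<ge> 0 \<and>
                              trace (diag1 X y t u) = 1}"

definition strategies2 :: "('n::finite, 'm::finite) mat2 set"
  where "strategies2 =
    {diag2 X y t | X y t. psd X \<and> nonneg_vec y \<and> t \<ge> 0 \<and> trace (diag2 X y t) = 1}"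

text \<open>The payoff reads off the blocks of its two arguments and ignores all other entries.\<close>

definition dantzig_payoff ::
    "('m::finite \<Rightarrow> real^'n::finite^'n) \<Rightarrow> real^'m \<Rightarrow> real^'n^'n \<Rightarrow> real \<Rightarrow>
     ('n, 'm) mat1 \<Rightarrow> ('n, 'm) mat2 \<Rightarrow> real"
  where "dantzig_payoff A b C M Z1 Z2 =
    (let X1 = block1 Z1;
         y1 = diag_vec (block1 (block2 Z1));
         t1 = trace (block1 (block2 (block2 Z1)));
         u = trace (block2 (block2 (block2 Z1)));
         X2 = block1 Z2;
         y2 = diag_vec (block1 (block2 Z2));
         t2 = trace (block2 (block2 Z2))
     in (\<Sum>i\<in>UNIV. y1 $ i * (t2 * b $ i - trace_inner (A i) X2))
        + trace_inner X1 (lin_comb A y2 - t2 *\<^sub>R C)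
        + t1 * (trace_inner C X2 - b \<bullet> y2)
        + u * (trace X2 + (\<Sum>i\<in>UNIV. y2 $ i) - t2 * M))"

definition dantzig_value ::
    "('m::finite \<Rightarrow> real^'n::finite^'n) \<Rightarrow> real^'m \<Rightarrow> real^'n^'n \<Rightarrow> real \<Rightarrow> real"
  where "dantzig_value A b C M = game_value strategies1 strategies2 (dantzig_payoff A b C M)"

definition dantzig_optimal1 ::
    "('m::finite \<Rightarrow> real^'n::finite^'n) \<Rightarrow> real^'m \<Rightarrow> real^'n^'n \<Rightarrow> real \<Rightarrow>
     ('n, 'm) mat1 \<Rightarrow> bool"
  where "dantzig_optimal1 A b C M Z \<longleftrightarrow>
    optimal_strategy1 strategies1 strategies2 (dantzig_payoff A b C M) Z"

lemma dantzig_payoff_diag: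
  "dantzig_payoff A b C M (diag1 X1 y1 t1 u) (diag2 X2 y2 t2) =
    (\<Sum>i\<in>UNIV. y1 $ i * (t2 * b $ i - trace_inner (A i) X2))
    + trace_inner X1 (lin_comb A y2 - t2 *\<^sub>R C)
    + t1 * (trace_inner C X2 - b \<bullet> y2)
    + u * (trace X2 + (\<Sum>i\<in>UNIV. y2 $ i) - t2 * M)"
  by (simp add: dantzig_payoff_def diag1_def diag2_def dsum_def block1_def block2_def
      diag_vec_def diag_mat_def mat_def trace_def lin_comb_def trace_inner_def
      matrix_matrix_mult_def inner_vec_def)

lemma trace_dsum: "trace (P \<oplus>\<^sub>D Q) = trace P + trace Q"
  unfolding trace_def dsum_def
  by (simp add: UNIV_Plus_UNIV [symmetric] sum.Plus del: UNIV_Plus_UNIV)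

lemma trace_diag1: "trace (diag1 X y t u) = trace X + (\<Sum>i\<in>UNIV. y $ i) + t + u"
  by (simp add: diag1_def trace_dsum) (simp add: trace_def diag_mat_def mat_def)

lemma trace_diag2: "trace (diag2 X y t) = trace X + (\<Sum>i\<in>UNIV. y $ i) + t"
  by (simp add: diag2_def trace_dsum) (simp add: trace_def diag_mat_def mat_def)

end

theory Submission
  imports Defs
begin

text \<open>Let \<open>w\<close> be the optimal value of the auxiliary problem. A strictly unbounded direction makes
  this value attained (one of the blocks of the feasible set becomes compact, the other one can be
  moved far along the direction) and positive (one of the two programs is infeasible). Separating
  the values below \<open>w\<close> gives a multiplier \<open>(G, g, q)\<close> for the auxiliary problem; mixed with the
  last pure strategy of the first player it shows \<open>w \<le> v * (1 + M + w)\<close>.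

  The second player can answer an optimal strategy with any auxiliary solution \<open>(X, y, 1)\<close> of
  value \<open>w\<close>, which yields \<open>0 \<le> (u - v) * (trace X + sum y - (M + w))\<close>. The last factor is negative at a
  solution within the solution bound, and positive far out along the unbounded direction, so
  \<open>u = v\<close>. Then \<open>(X', y')\<close> satisfies the homogenised constraints of both programs with
  \<open>b \<bullet> y' > \<langle>C, X'\<rangle>\<close>, and weak duality excludes \<open>t' > 0\<close>.\<close>

section \<open>Positive semidefinite matrices\<close>

definition outer :: "real^'n \<Rightarrow> real^'n^'n"
  where "outer z = (\<chi> i j. z $ i * z $ j)"

text \<open>Reduces the trace form to the Euclidean inner product of the type, from which
  bilinearity and continuity are inherited. The transpose disappears only for symmetric
  \<open>X\<close>.\<close>

lemma trace_inner_eq_inner: "trace_inner X Y = transpose X \<bullet> Y"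
proof -
  have "trace_inner X Y = (\<Sum>i\<in>UNIV. \<Sum>j\<in>UNIV. X $ i $ j * Y $ j $ i)"
    by (simp add: trace_inner_def trace_def matrix_matrix_mult_def)
  also have "\<dots> = (\<Sum>j\<in>UNIV. \<Sum>i\<in>UNIV. X $ i $ j * Y $ j $ i)"
    by (rule sum.swap)
  finally show ?thesis
    by (simp add: inner_vec_def transpose_def)
qed

lemma trace_inner_commute: "trace_inner X Y = trace_inner Y X"
  unfolding trace_inner_def by (rule trace_mul_sym)

lemma sym_trace_inner: "sym_mat X \<Longrightarrow> trace_inner X Y = X \<bullet> Y"
  by (simp add: trace_inner_eq_inner sym_mat_def)

lemma trace_zero: "trace (0 :: real^'n::finite^'n) = 0"
  by (simp add: trace_def)

lemma trace_inner_add_right: "trace_inner X (Y + Z) = trace_inner X Y + trace_inner X Z"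
  and trace_inner_diff_right: "trace_inner X (Y - Z) = trace_inner X Y - trace_inner X Z"
  and trace_inner_scaleR_right: "trace_inner X (c *\<^sub>R Y) = c * trace_inner X Y"
  and trace_inner_zero_right: "trace_inner X 0 = 0"
  by (simp_all add: trace_inner_eq_inner inner_right_distrib inner_diff_right)

lemma trace_inner_add_left: "trace_inner (Y + Z) X = trace_inner Y X + trace_inner Z X"
  and trace_inner_diff_left: "trace_inner (Y - Z) X = trace_inner Y X - trace_inner Z X"
  and trace_inner_scaleR_left: "trace_inner (c *\<^sub>R Y) X = c * trace_inner Y X"
  and trace_inner_zero_left: "trace_inner 0 X = 0"
  using trace_inner_add_right[of X Y Z] trace_inner_diff_right[of X Y Z]
    trace_inner_scaleR_right[of X c Y] trace_inner_zero_right[of X]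
  by (simp_all only: trace_inner_commute[of X])

lemma trace_inner_minus_left: "trace_inner (- Y) X = - trace_inner Y X"
  using trace_inner_scaleR_left[of "-1" Y X] by simp

lemmas trace_inner_simps =
  trace_inner_add_right trace_inner_diff_right trace_inner_scaleR_right trace_inner_zero_right
  trace_inner_add_left trace_inner_diff_left trace_inner_scaleR_left trace_inner_zero_left

lemma mat_eq_scaleR: "mat (w::real) = w *\<^sub>R mat 1"
  by (simp add: mat_def vec_eq_iff)

lemma trace_inner_mat: "trace_inner X (mat w) = w * trace X"
proof -
  have "trace_inner X (mat 1) = trace X"
    by (simp add: trace_inner_def)
  then show ?thesis
    by (subst mat_eq_scaleR) (simp add: trace_inner_scaleR_right)
qed

lemma trace_inner_mat_left: "trace_inner (mat w) X = w * trace X"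
  by (simp only: trace_inner_commute[of "mat w"] trace_inner_mat)

lemma trace_inner_lin_comb:
  "trace_inner (lin_comb A y) X = (\<Sum>i\<in>UNIV. y $ i * trace_inner (A i) X)"
proof -
  have "trace_inner X (lin_comb A y) = (\<Sum>i\<in>UNIV. y $ i * trace_inner X (A i))"
    by (simp add: lin_comb_def trace_inner_eq_inner inner_sum_right)
  then show ?thesis by (simp only: trace_inner_commute[of X])
qed

lemma lin_comb_add: "lin_comb A (x + y) = lin_comb A x + lin_comb A y"
  by (simp add: lin_comb_def scaleR_left_distrib sum.distrib)

lemma lin_comb_scaleR: "lin_comb A (c *\<^sub>R y) = c *\<^sub>R lin_comb A y"
  by (simp add: lin_comb_def scaleR_sum_right)

lemma lin_comb_zero: "lin_comb A 0 = 0"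
  by (simp add: lin_comb_def)

lemma lin_comb_axis: "lin_comb A (axis i 1) = A i"
  by (simp add: lin_comb_def axis_def if_distrib[of "\<lambda>x. x *\<^sub>R _"] cong: if_cong)

lemma sym_mat_iff: "sym_mat X \<longleftrightarrow> (\<forall>i j. X $ i $ j = X $ j $ i)"
  unfolding sym_mat_def transpose_def vec_eq_iff by auto

lemma sym_outer: "sym_mat (outer z)"
  by (simp add: sym_mat_iff outer_def)

lemma sym_lin_comb:
  assumes "\<And>i. sym_mat (A i)"
  shows "sym_mat (lin_comb A y)"
  unfolding sym_mat_iff
proof (intro allI)
  fix j k
  have "A i $ j $ k = A i $ k $ j" for i
    using assms[of i] unfolding sym_mat_iff by blast
  then show "lin_comb A y $ j $ k = lin_comb A y $ k $ j"
    by (simp only: lin_comb_def sum_component vector_scaleR_component)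
qed

lemma sym_mat_mat: "sym_mat (mat w)"
  by (simp add: sym_mat_def)

lemma sym_mat_add: "sym_mat X \<Longrightarrow> sym_mat Y \<Longrightarrow> sym_mat (X + Y)"
  unfolding sym_mat_iff vector_add_component by metis

lemma sym_mat_diff: "sym_mat X \<Longrightarrow> sym_mat Y \<Longrightarrow> sym_mat (X - Y)"
  unfolding sym_mat_iff vector_minus_component by metis

lemma sym_mat_scaleR: "sym_mat X \<Longrightarrow> sym_mat (c *\<^sub>R X)"
  unfolding sym_mat_iff vector_scaleR_component by metis

text \<open>This makes the quadratic form visibly linear in \<open>P\<close>. Sums, differences,
  closedness and norm bounds then follow from rules for the inner product, without any spectral
  theory.\<close>

lemma quad_form_eq_inner: "z \<bullet> (P *v z) = outer z \<bullet> P"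
  by (simp add: inner_vec_def matrix_vector_mult_def outer_def sum_distrib_left
      sum_distrib_right mult_ac)

lemma trace_inner_outer: "trace_inner (outer z) P = z \<bullet> (P *v z)"
  by (simp add: sym_trace_inner[OF sym_outer] quad_form_eq_inner)

lemma trace_outer: "trace (outer z) = z \<bullet> z"
  by (simp add: trace_def outer_def inner_vec_def)

lemma quad_form_outer: "z \<bullet> (outer x *v z) = (x \<bullet> z)\<^sup>2"
  unfolding quad_form_eq_inner
  by (simp add: outer_def inner_vec_def power2_eq_square sum_product) (simp add: mult_ac)

lemma quad_form_mat: "z \<bullet> (mat w *v z) = w * (z \<bullet> z)"
  by (subst mat_eq_scaleR) (simp add: scaleR_matrix_vector_assoc[symmetric])

section \<open>The cone of positive semidefinite matrices\<close>

lemma psdI: "sym_mat X \<Longrightarrow> (\<And>z. 0 \<le> z \<bullet> (X *v z)) \<Longrightarrow> psd X"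
  by (simp add: psd_def)

lemma psd_symD: "psd X \<Longrightarrow> sym_mat X"
  by (simp add: psd_def)

lemma psd_zero: "psd 0"
  by (simp add: psd_def sym_mat_def transpose_def vec_eq_iff)

lemma psd_add: "psd X \<Longrightarrow> psd Y \<Longrightarrow> psd (X + Y)"
  by (simp add: psd_def sym_mat_add quad_form_eq_inner inner_right_distrib)

lemma psd_scaleR: "psd X \<Longrightarrow> 0 \<le> c \<Longrightarrow> psd (c *\<^sub>R X)"
  by (simp add: psd_def sym_mat_scaleR quad_form_eq_inner)

lemma psd_outer: "psd (outer z)"
  by (simp add: psd_def sym_outer quad_form_outer)

lemma quad_form_axis: "axis i 1 \<bullet> (X *v axis i 1) = X $ i $ i"
  by (simp add: matrix_vector_mult_basis inner_axis' column_def)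

lemma psd_diag_nonneg: "psd X \<Longrightarrow> 0 \<le> X $ i $ i"
  by (metis psd_def quad_form_axis)

lemma sym_quad_form_shift:
  assumes "sym_mat X"
  shows "(z + s *\<^sub>R axis i 1) \<bullet> (X *v (z + s *\<^sub>R axis i 1)) =
    z \<bullet> (X *v z) + 2 * s * (X *v z) $ i + s\<^sup>2 * X $ i $ i"
proof -
  have "z \<bullet> (X *v axis i 1) = (X *v z) $ i"
    using assms
    by (metis sym_mat_def dot_lmul_matrix matrix_vector_mul_component transpose_matrix_vector
        inner_commute inner_axis inner_real_def mult.right_neutral)
  then show ?thesis
    using quad_form_axis[of i X]
    by (simp add: matrix_vector_right_distrib inner_add_left inner_add_right
        matrix_vector_mult_scaleR inner_axis' power2_eq_square algebra_simps)
qed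

text \<open>With vanishing diagonal, the form at \<open>axis j 1 + s *\<^sub>R axis i 1\<close> is
  linear in \<open>s\<close>. Being nonnegative for \<open>s = 1\<close> and \<open>s = -1\<close>,
  it forces the off-diagonal entry to vanish.\<close>

lemma psd_diag_zero:
  assumes "psd X" "\<And>i. X $ i $ i = 0"
  shows "X = 0"
proof -
  have "X $ i $ j = 0" for i j
  proof -
    have s: "0 \<le> 2 * s * X $ i $ j" for s
    proof -
      have "0 \<le> (axis j 1 + s *\<^sub>R axis i 1) \<bullet> (X *v (axis j 1 + s *\<^sub>R axis i 1))"
        using assms(1) by (simp add: psd_def)
      then show ?thesis
        unfolding sym_quad_form_shift[OF psd_symD[OF assms(1)]] quad_form_axis
        by (simp add: assms(2) matrix_vector_mult_basis column_def)
    qed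
    from s[of 1] s[of "-1"] show ?thesis by simp
  qed
  then show ?thesis by (simp add: vec_eq_iff)
qed

text \<open>Induction by symmetric Gaussian elimination: subtracting a rank-one matrix clears a diagonal
  entry and keeps the zero diagonal entries.\<close>

lemma psd_trace_inner_nonneg:
  assumes "psd X" "psd Y"
  shows "0 \<le> trace_inner X Y"
  using assms(1)
proof (induction "card {i. X $ i $ i \<noteq> 0}" arbitrary: X rule: less_induct)
  case less
  show ?case
  proof (cases "\<exists>i. X $ i $ i \<noteq> 0")
    case False
    then have "X = 0" using psd_diag_zero less.prems by blast
    then show ?thesis by (simp add: trace_inner_simps)
  next
    case True
    then obtain i where i: "X $ i $ i \<noteq> 0" by blast
    then have pos: "0 < X $ i $ i"
      using psd_diag_nonneg[OF less.prems, of i] by simp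
    define c where "c = row i X"
    define X' where "X' = X - (1 / X $ i $ i) *\<^sub>R outer c"
    have cz: "c \<bullet> z = (X *v z) $ i" for z
      by (simp add: c_def matrix_vector_mul_component row_def)
    have psd': "psd X'"
    proof (rule psdI)
      show "sym_mat X'"
        unfolding X'_def
        by (intro sym_mat_diff sym_mat_scaleR sym_outer psd_symD less.prems)
    next
      fix z
      have "z \<bullet> (X' *v z) = z \<bullet> (X *v z) - ((X *v z) $ i)\<^sup>2 / X $ i $ i"
        using quad_form_outer[of z c]
        by (simp add: X'_def quad_form_eq_inner inner_diff_right cz)
      \<comment> \<open>The shift along \<open>axis i 1\<close> is the minimiser of the quadratic in
        \<open>sym_quad_form_shift\<close>. Completing the square thus writes the reduced form as a
        value of the form of \<open>X\<close>.\<close>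
      also have "\<dots> = (z + (- (X *v z) $ i / X $ i $ i) *\<^sub>R axis i 1) \<bullet>
          (X *v (z + (- (X *v z) $ i / X $ i $ i) *\<^sub>R axis i 1))"
        using pos unfolding sym_quad_form_shift[OF psd_symD[OF less.prems]]
        by (simp add: field_simps power2_eq_square)
      also have "\<dots> \<ge> 0"
        using less.prems by (simp add: psd_def)
      finally show "0 \<le> z \<bullet> (X' *v z)" .
    qed
    have diag: "X' $ j $ j = X $ j $ j - (X $ i $ j)\<^sup>2 / X $ i $ i" for j
      by (simp add: X'_def outer_def c_def row_def power2_eq_square)
    have "X' $ j $ j = 0" if "X $ j $ j = 0" for j
    proof -
      have "X' $ j $ j \<le> 0" using that pos by (simp add: diag)
      then show ?thesis using psd_diag_nonneg[OF psd', of j] by simp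
    qed
    moreover have "X' $ i $ i = 0"
      using i by (simp add: diag power2_eq_square)
    ultimately have "{j. X' $ j $ j \<noteq> 0} \<subset> {j. X $ j $ j \<noteq> 0}"
      using i by blast
    then have "card {j. X' $ j $ j \<noteq> 0} < card {j. X $ j $ j \<noteq> 0}"
      by (simp add: psubset_card_mono)
    then have "0 \<le> trace_inner X' Y"
      using less.hyps psd' by blast
    moreover have "trace_inner X' Y = trace_inner X Y - c \<bullet> (Y *v c) / X $ i $ i"
      by (simp add: X'_def trace_inner_simps trace_inner_outer)
    moreover have "0 \<le> c \<bullet> (Y *v c) / X $ i $ i"
      using assms(2) pos by (simp add: psd_def)
    ultimately show ?thesis by simp
  qed
qed

lemma psd_trace_nonneg: "psd X \<Longrightarrow> 0 \<le> trace X"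
  by (simp add: trace_def sum_nonneg psd_diag_nonneg)

text \<open>Two applications of self-duality replace eigenvalues. By Cauchy-Schwarz,
  \<open>mat (z \<bullet> z) - outer z\<close> is positive semidefinite, and pairing it with
  \<open>X\<close> shows that \<open>mat (trace X) - X\<close> is too. Pairing the latter with
  \<open>X\<close> bounds the squared norm. A trace bound therefore yields a norm bound, as needed
  for compactness.\<close>

lemma psd_norm_le_trace:
  assumes "psd X"
  shows "norm X \<le> trace X"
proof -
  have le: "z \<bullet> (X *v z) \<le> trace X * (z \<bullet> z)" for z
  proof -
    have "psd (mat (z \<bullet> z) - outer z)"
    proof (rule psdI)
      show "sym_mat (mat (z \<bullet> z) - outer z)"
        by (intro sym_mat_diff sym_mat_mat sym_outer)
      show "0 \<le> x \<bullet> ((mat (z \<bullet> z) - outer z) *v x)" for x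
        using Cauchy_Schwarz_ineq[of z x] quad_form_outer[of x z] quad_form_mat[of x "z \<bullet> z"]
        by (simp add: quad_form_eq_inner inner_diff_right)
    qed
    from psd_trace_inner_nonneg[OF assms this] show ?thesis
      by (simp add: trace_inner_simps trace_inner_mat trace_inner_commute[of X "outer z"]
          trace_inner_outer mult.commute)
  qed
  have "psd (mat (trace X) - X)"
  proof (rule psdI)
    show "sym_mat (mat (trace X) - X)"
      by (intro sym_mat_diff sym_mat_mat psd_symD assms)
    show "0 \<le> z \<bullet> ((mat (trace X) - X) *v z)" for z
      using quad_form_mat[of z "trace X"] le[of z]
      by (simp add: quad_form_eq_inner inner_diff_right)
  qed
  from psd_trace_inner_nonneg[OF assms this]
  have "trace_inner X X \<le> trace X * trace X"
    by (simp add: trace_inner_simps trace_inner_mat)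
  then have "(norm X)\<^sup>2 \<le> (trace X)\<^sup>2"
    by (simp add: sym_trace_inner psd_symD assms dot_square_norm power2_eq_square)
  then show ?thesis
    by (rule power2_le_imp_le) (rule psd_trace_nonneg[OF assms])
qed

lemma quad_form_bound:
  fixes P :: "real^'n::finite^'n"
  shows "\<bar>z \<bullet> (P *v z)\<bar> \<le> norm P * (z \<bullet> z)"
proof -
  have "\<bar>outer z \<bullet> P\<bar> \<le> norm (outer z) * norm P"
    by (rule Cauchy_Schwarz_ineq2)
  also have "\<dots> \<le> (z \<bullet> z) * norm P"
    using psd_norm_le_trace[OF psd_outer, of z] by (intro mult_right_mono) (simp_all add: trace_outer)
  finally show ?thesis by (simp add: quad_form_eq_inner mult.commute)
qed

text \<open>The Euclidean norm of a matrix dominates its quadratic form on unit vectors. This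
  supplies explicit feasible values of \<open>w\<close> in the auxiliary problem.\<close>

lemma psd_add_mat:
  fixes P :: "real^'n::finite^'n"
  assumes "sym_mat P" "norm P \<le> w"
  shows "psd (P + mat w)"
proof (intro psdI sym_mat_add sym_mat_mat assms(1))
  fix z :: "real^'n"
  have "norm P * (z \<bullet> z) \<le> w * (z \<bullet> z)"
    using assms(2) by (intro mult_right_mono) simp_all
  then show "0 \<le> z \<bullet> ((P + mat w) *v z)"
    using quad_form_bound[of z P] quad_form_mat[of z w]
    by (simp add: quad_form_eq_inner inner_right_distrib)
qed

lemma psd_mat: "0 \<le> w \<Longrightarrow> psd (mat w)"
  using psd_add_mat[of 0 w] psd_symD[OF psd_zero] by simp

text \<open>Take \<open>d\<close> to be the minimum of the form on the compact unit sphere, which is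
  attained and hence positive; homogeneity extends the bound to all vectors.\<close>

lemma pd_ge_mat:
  fixes P :: "real^'n::finite^'n"
  assumes "pd P"
  obtains d where "0 < d" "psd (P - mat d)"
proof -
  have "compact (sphere (0::real^'n) 1)" "sphere (0::real^'n) 1 \<noteq> {}"
    by (simp_all)
  moreover have "continuous_on (sphere 0 1) (\<lambda>z. z \<bullet> (P *v z))"
    by (intro continuous_intros linear_continuous_on linear_linear[THEN iffD2] matrix_vector_mul_linear)
  ultimately obtain x where x: "x \<in> sphere 0 1"
    and le: "\<And>z. z \<in> sphere 0 1 \<Longrightarrow> x \<bullet> (P *v x) \<le> z \<bullet> (P *v z)"
    using continuous_attains_inf[of "sphere 0 1" "\<lambda>z. z \<bullet> (P *v z)"] by blast
  define d where "d = x \<bullet> (P *v x)"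
  have "x \<noteq> 0" using x by auto
  then have "0 < d" using assms by (simp add: d_def pd_def)
  moreover have "psd (P - mat d)"
  proof (intro psdI sym_mat_diff sym_mat_mat)
    show "sym_mat P" using assms by (simp add: pd_def)
    fix z :: "real^'n"
    have "d * (z \<bullet> z) \<le> z \<bullet> (P *v z)"
    proof (cases "z = 0")
      case False
      have "d \<le> (z /\<^sub>R norm z) \<bullet> (P *v (z /\<^sub>R norm z))"
        using False unfolding d_def by (intro le) simp
      also have "\<dots> = (z \<bullet> (P *v z)) / (z \<bullet> z)"
        by (simp add: matrix_vector_mult_scaleR dot_square_norm power2_eq_square divide_inverse)
      finally show ?thesis
        using False by (simp add: pos_le_divide_eq)
    qed simp
    then show "0 \<le> z \<bullet> ((P - mat d) *v z)"
      using quad_form_mat[of z d] by (simp add: quad_form_eq_inner inner_diff_right)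
  qed
  ultimately show ?thesis by (rule that)
qed

lemma closed_psd: "closed {X. psd X}"
proof -
  have "{X. psd X} = {X. \<forall>i j. X $ j $ i = X $ i $ j} \<inter> {X. \<forall>z. 0 \<le> outer z \<bullet> X}"
    by (auto simp: psd_def sym_mat_def transpose_def vec_eq_iff quad_form_eq_inner)
  also have "closed \<dots>"
    by (intro closed_Int closed_Collect_all closed_Collect_eq closed_Collect_le continuous_intros)
  finally show ?thesis .
qed

lemma inner_transpose: "transpose X \<bullet> transpose Y = X \<bullet> (Y :: real^'n::finite^'n)"
proof -
  have "transpose X \<bullet> transpose Y = (\<Sum>i\<in>UNIV. \<Sum>j\<in>UNIV. X $ j $ i * Y $ j $ i)"
    by (simp add: inner_vec_def transpose_def)
  also have "\<dots> = (\<Sum>j\<in>UNIV. \<Sum>i\<in>UNIV. X $ j $ i * Y $ j $ i)"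
    by (rule sum.swap)
  finally show ?thesis by (simp add: inner_vec_def)
qed

lemma quad_form_transpose: "z \<bullet> (transpose X *v z) = z \<bullet> (X *v (z :: real^'n::finite))"
proof -
  have "outer z \<bullet> transpose X = transpose (outer z) \<bullet> transpose X"
    using sym_outer[of z] by (simp add: sym_mat_def)
  then show ?thesis by (simp only: quad_form_eq_inner inner_transpose)
qed

text \<open>The test matrices \<open>R\<close> need not be symmetric. Hence the antisymmetric matrix
  \<open>K\<close> and its negative are both admissible, so \<open>G\<close> is orthogonal to
  \<open>K\<close> and \<open>K\<close> vanishes. This is what makes a separating functional on the
  full matrix space symmetric.\<close>

lemma psd_of_inner_nonneg:
  assumes "\<And>R. (\<And>z. 0 \<le> z \<bullet> (R *v z)) \<Longrightarrow> 0 \<le> G \<bullet> (R :: real^'n::finite^'n)"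
  shows "psd G"
proof (rule psdI)
  define K where "K = G - transpose G"
  have K: "z \<bullet> (K *v z) = 0" for z
    using quad_form_transpose[of z G] unfolding K_def quad_form_eq_inner inner_diff_right by simp
  have "0 \<le> G \<bullet> K" using K by (intro assms) simp
  moreover have "0 \<le> G \<bullet> (- K)"
    using K by (intro assms) (simp add: quad_form_eq_inner)
  moreover have "K \<bullet> K = 2 * (G \<bullet> K)"
    using inner_transpose[of G G]
    by (simp add: K_def inner_diff_left inner_diff_right inner_commute)
  ultimately have "K \<bullet> K = 0" by simp
  then show "sym_mat G" by (simp add: K_def sym_mat_def)
  show "0 \<le> z \<bullet> (G *v z)" for z
  proof -
    have "0 \<le> G \<bullet> outer z" by (rule assms) (simp add: quad_form_outer)
    then show ?thesis by (simp add: quad_form_eq_inner inner_commute)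
  qed
qed

section \<open>The auxiliary problem\<close>

text \<open>Serves to read sign conditions off the separation inequality by moving along a ray. At a
  positive slope, \<open>k = (\<bar>c\<bar> + 1) / d\<close> would give a value of at least
  1.\<close>

lemma affine_bounded_imp_slope_nonpos:
  fixes c d :: real
  assumes "\<And>k. 0 \<le> k \<Longrightarrow> c + k * d \<le> 0"
  shows "d \<le> 0"
proof (rule ccontr)
  assume "\<not> d \<le> 0"
  then have "c + ((\<bar>c\<bar> + 1) / d) * d \<le> 0"
    by (intro assms) simp
  with \<open>\<not> d \<le> 0\<close> show False by simp
qed

section \<open>Attainment in the auxiliary problem\<close>

lemma nonneg_vec_term_le_sum:
  fixes y :: "real^'m::finite"
  assumes "nonneg_vec y" "\<And>i. 0 \<le> a i"
  shows "y $ i * a i \<le> (\<Sum>i\<in>UNIV. y $ i * a i)"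
  using assms by (intro member_le_sum) (auto simp: nonneg_vec_def)

lemma closed_nonneg_vec: "closed {y. nonneg_vec y}"
  unfolding nonneg_vec_def
  by (intro closed_Collect_all closed_Collect_le continuous_intros)

text \<open>Only the matrix constraint on \<open>(y, w)\<close> is kept first. Pairing it with
  \<open>W\<close> bounds \<open>y\<close>, so \<open>w\<close> has a minimum on the truncated set
  \<open>F\<close>. A large multiple of \<open>W\<close> as \<open>X\<close> then meets the
  remaining constraints without changing \<open>w\<close>.\<close>

lemma aux_attained_primal:
  fixes A :: "'m::finite \<Rightarrow> real^'n::finite^'n"
  assumes "sym_mat C" "primal_strictly_unbounded_dir A C W"
  shows "\<exists>X y w. aux_optimal A b C X y w"
proof -
  have W: "psd W" "\<And>i. 0 < trace_inner (A i) W" "trace_inner C W < 0"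
    using assms(2) by (simp_all add: primal_strictly_unbounded_dir_def)
  \<comment> \<open>The cut-off \<open>norm C\<close> is itself a feasible value of
    \<open>w\<close>, attained with \<open>y = 0\<close>, so truncation does not change the
    minimum.\<close>
  define F where "F = {(y, w). nonneg_vec y \<and> 0 \<le> w \<and> w \<le> norm C \<and> lin_comb A y - mat w \<preceq>\<^sub>L C}"
  define u :: "real^'m"
    where "u = (\<chi> i. (trace_inner C W + norm C * trace W) / trace_inner (A i) W)"
  have "F \<subseteq> cbox 0 u \<times> cbox 0 (norm C)"
  proof
    fix p assume "p \<in> F"
    then obtain y w where p: "p = (y, w)" and y: "nonneg_vec y" and w: "0 \<le> w" "w \<le> norm C"
      and le: "psd (C - (lin_comb A y - mat w))"
      by (auto simp: F_def loewner_le_def)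
    have "0 \<le> trace_inner (C - (lin_comb A y - mat w)) W"
      by (rule psd_trace_inner_nonneg[OF le W(1)])
    then have "(\<Sum>i\<in>UNIV. y $ i * trace_inner (A i) W) \<le> trace_inner C W + w * trace W"
      by (simp add: trace_inner_simps trace_inner_lin_comb trace_inner_mat_left)
    also have "\<dots> \<le> trace_inner C W + norm C * trace W"
      using w psd_trace_nonneg[OF W(1)] by (simp add: mult_right_mono)
    finally have "y $ i * trace_inner (A i) W \<le> trace_inner C W + norm C * trace W" for i
      using nonneg_vec_term_le_sum[OF y, of "\<lambda>i. trace_inner (A i) W" i] W(2)
      by (meson less_imp_le order_trans)
    then have "y $ i \<le> u $ i" for i
      using W(2)[of i] by (simp add: u_def pos_le_divide_eq)
    then show "p \<in> cbox 0 u \<times> cbox 0 (norm C)"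
      using y w p by (simp add: mem_box_cart nonneg_vec_def)
  qed
  moreover have "closed F"
  proof -
    have "F = (fst -` {y. nonneg_vec y} \<inter> snd -` {0..norm C}) \<inter>
        (\<lambda>p. C - (lin_comb A (fst p) - snd p *\<^sub>R mat 1)) -` {X. psd X}"
      by (auto simp: F_def loewner_le_def mat_eq_scaleR[symmetric])
    also have "closed \<dots>"
      unfolding lin_comb_def
      by (intro closed_Int closed_vimage closed_psd closed_nonneg_vec closed_atLeastAtMost
          continuous_intros)
    finally show ?thesis .
  qed
  ultimately have "compact F"
    using compact_Int_closed[of "cbox 0 u \<times> cbox 0 (norm C)" F]
    by (simp add: compact_Times Int_absorb1)
  moreover have "(0, norm C) \<in> F"
    using psd_add_mat[OF assms(1), of "norm C"]
    by (simp add: F_def loewner_le_def lin_comb_zero nonneg_vec_def)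
  then have "F \<noteq> {}" by blast
  moreover have "continuous_on F snd"
    by (intro continuous_intros)
  ultimately obtain p where "p \<in> F" and p: "\<And>q. q \<in> F \<Longrightarrow> snd p \<le> snd q"
    using continuous_attains_inf by metis
  then obtain y w where yw: "(y, w) \<in> F" and min: "\<And>y' w'. (y', w') \<in> F \<Longrightarrow> w \<le> w'"
    by (metis prod.collapse snd_conv)
  \<comment> \<open>The summands are the individual thresholds: one for each constraint on
    \<open>A i\<close>, and the last for the constraint on the duality gap. All are nonnegative, so
    their sum exceeds each of them.\<close>
  define l where "l = (\<Sum>i\<in>UNIV. \<bar>b $ i\<bar> / trace_inner (A i) W) + \<bar>b \<bullet> y\<bar> / - trace_inner C W"
  have l1: "0 \<le> (\<Sum>i\<in>UNIV. \<bar>b $ i\<bar> / trace_inner (A i) W)"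
    using W(2) by (intro sum_nonneg divide_nonneg_pos) auto
  have l2: "0 \<le> \<bar>b \<bullet> y\<bar> / - trace_inner C W"
    using W(3) by (intro divide_nonneg_pos) auto
  have "b $ i \<le> l * trace_inner (A i) W" for i
  proof -
    have "\<bar>b $ i\<bar> / trace_inner (A i) W \<le> (\<Sum>i\<in>UNIV. \<bar>b $ i\<bar> / trace_inner (A i) W)"
      using W(2) by (intro member_le_sum divide_nonneg_pos) auto
    then have "\<bar>b $ i\<bar> / trace_inner (A i) W \<le> l"
      using l2 by (simp add: l_def)
    then show ?thesis
      using W(2)[of i] by (simp add: pos_divide_le_eq)
  qed
  moreover have "l * trace_inner C W \<le> b \<bullet> y"
  proof -
    have "\<bar>b \<bullet> y\<bar> / - trace_inner C W \<le> l"
      using l1 by (simp add: l_def)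
    then have "\<bar>b \<bullet> y\<bar> \<le> l * - trace_inner C W"
      using W(3) by (subst (asm) pos_divide_le_eq) auto
    then show ?thesis by simp
  qed
  moreover have "0 \<le> l" using l1 l2 by (simp add: l_def)
  ultimately have "aux_feasible A b C (l *\<^sub>R W) y w"
    using yw W(1)
    by (auto simp: aux_feasible_def F_def trace_inner_simps psd_scaleR intro: add_increasing2)
  moreover have "w \<le> w'" if "aux_feasible A b C X' y' w'" for X' y' w'
  proof (cases "w' \<le> norm C")
    case True
    then show ?thesis using that by (intro min[of y']) (simp add: F_def aux_feasible_def)
  next
    case False
    then show ?thesis using yw by (simp add: F_def)
  qed
  ultimately show ?thesis by (auto simp: aux_optimal_def)
qed

text \<open>The roles are exchanged: the constraints on \<open>(X, w)\<close> alone have a compact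
  truncation, because the definiteness margin \<open>e\<close> of \<open>- lin_comb A d\<close>
  bounds \<open>trace X\<close>. A large multiple of \<open>d\<close> as \<open>y\<close> repairs
  the rest.\<close>

lemma aux_attained_dual:
  fixes A :: "'m::finite \<Rightarrow> real^'n::finite^'n"
  assumes "sym_mat C" "dual_strictly_unbounded_dir A b d"
  shows "\<exists>X y w. aux_optimal A b C X y w"
proof -
  have d: "nonneg_vec d" "pd (- lin_comb A d)" "0 < b \<bullet> d"
    using assms(2) by (simp_all add: dual_strictly_unbounded_dir_def loewner_less_def)
  obtain e where e: "0 < e" "psd (- lin_comb A d - mat e)"
    using pd_ge_mat[OF d(2)] .
  define s where "s = (\<Sum>i\<in>UNIV. \<bar>b $ i\<bar>)"
  have bs: "b $ i \<le> s" for i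
  proof -
    have "\<bar>b $ i\<bar> \<le> s" unfolding s_def by (intro member_le_sum) auto
    then show ?thesis by simp
  qed
  define F where "F = {(X, w). psd X \<and> 0 \<le> w \<and> w \<le> s \<and> (\<forall>i. b $ i \<le> trace_inner (A i) X + w)}"
  define R where "R = (s * (\<Sum>i\<in>UNIV. d $ i) - b \<bullet> d) / e"
  have "F \<subseteq> cball 0 R \<times> cbox 0 s"
  proof
    fix p assume "p \<in> F"
    then obtain X w where p: "p = (X, w)" and X: "psd X" and w: "0 \<le> w" "w \<le> s"
      and le: "\<And>i. b $ i \<le> trace_inner (A i) X + w"
      by (auto simp: F_def)
    have "0 \<le> trace_inner (- lin_comb A d - mat e) X"
      by (rule psd_trace_inner_nonneg[OF e(2) X])
    then have "trace X * e \<le> - trace_inner (lin_comb A d) X"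
      using trace_inner_scaleR_left[of "-1" "lin_comb A d" X]
      by (simp add: trace_inner_simps trace_inner_mat_left mult.commute)
    also have "\<dots> = (\<Sum>i\<in>UNIV. d $ i * - trace_inner (A i) X)"
      by (simp add: trace_inner_lin_comb sum_negf)
    also have "\<dots> \<le> (\<Sum>i\<in>UNIV. d $ i * (s - b $ i))"
    proof (intro sum_mono mult_left_mono)
      show "- trace_inner (A i) X \<le> s - b $ i" for i using le[of i] w by simp
      show "0 \<le> d $ i" for i using d(1) by (simp add: nonneg_vec_def)
    qed
    also have "\<dots> = s * (\<Sum>i\<in>UNIV. d $ i) - b \<bullet> d"
      by (simp add: inner_vec_def sum_distrib_left sum_subtractf algebra_simps)
    finally have "trace X \<le> R"
      using e(1) by (simp add: R_def pos_le_divide_eq)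
    then show "p \<in> cball 0 R \<times> cbox 0 s"
      using psd_norm_le_trace[OF X] w p by simp
  qed
  moreover have "closed F"
  proof -
    have "F = (fst -` {X. psd X} \<inter> snd -` {0..s}) \<inter>
        {p. \<forall>i. b $ i \<le> transpose (A i) \<bullet> fst p + snd p}"
      by (auto simp: F_def trace_inner_eq_inner)
    also have "closed \<dots>"
      by (intro closed_Int closed_vimage closed_psd closed_atLeastAtMost closed_Collect_all
          closed_Collect_le continuous_intros)
    finally show ?thesis .
  qed
  ultimately have "compact F"
    using compact_Int_closed[of "cball 0 R \<times> cbox 0 s" F]
    by (simp add: compact_Times Int_absorb1)
  moreover have "(0, s) \<in> F"
    using bs by (simp add: F_def psd_zero trace_inner_simps) (simp add: s_def sum_nonneg)
  then have "F \<noteq> {}" by blast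
  moreover have "continuous_on F snd"
    by (intro continuous_intros)
  ultimately obtain p where "p \<in> F" and p: "\<And>q. q \<in> F \<Longrightarrow> snd p \<le> snd q"
    using continuous_attains_inf by metis
  then obtain X w where Xw: "(X, w) \<in> F" and min: "\<And>X' w'. (X', w') \<in> F \<Longrightarrow> w \<le> w'"
    by (metis prod.collapse snd_conv)
  have w: "0 \<le> w" using Xw by (simp add: F_def)
  \<comment> \<open>The first summand makes the margin \<open>l * e\<close> absorb
    \<open>norm C\<close> in the matrix constraint; the second closes the duality gap.\<close>
  define l where "l = norm C / e + \<bar>trace_inner C X\<bar> / (b \<bullet> d)"
  have l1: "0 \<le> norm C / e" and l2: "0 \<le> \<bar>trace_inner C X\<bar> / (b \<bullet> d)"
    using e(1) d(3) by simp_all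
  have l: "0 \<le> l" using l1 l2 by (simp add: l_def)
  have "trace_inner C X \<le> l * (b \<bullet> d)"
  proof -
    have "\<bar>trace_inner C X\<bar> / (b \<bullet> d) \<le> l" using l1 by (simp add: l_def)
    then have "\<bar>trace_inner C X\<bar> \<le> l * (b \<bullet> d)" using d(3) by (simp add: pos_divide_le_eq)
    then show ?thesis by simp
  qed
  moreover have "psd (C - (lin_comb A (l *\<^sub>R d) - mat w))"
  proof -
    have "norm C / e \<le> l" using l2 by (simp add: l_def)
    then have "norm C \<le> l * e + w" using e(1) w by (simp add: pos_divide_le_eq)
    then have "psd ((C + mat (l * e + w)) + l *\<^sub>R (- lin_comb A d - mat e))"
      by (intro psd_add psd_add_mat psd_scaleR assms(1) e(2) l)
    moreover have "(C + mat (l * e + w)) + l *\<^sub>R (- lin_comb A d - mat e) =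
        C - (lin_comb A (l *\<^sub>R d) - mat w)"
      unfolding mat_eq_scaleR[of "l * e + w"] mat_eq_scaleR[of e] mat_eq_scaleR[of w]
      by (simp add: lin_comb_scaleR algebra_simps)
    ultimately show ?thesis by simp
  qed
  moreover have "nonneg_vec (l *\<^sub>R d)"
    using d(1) l by (simp add: nonneg_vec_def)
  ultimately have "aux_feasible A b C X (l *\<^sub>R d) w"
    using Xw by (simp add: aux_feasible_def F_def loewner_le_def)
  moreover have "w \<le> w'" if "aux_feasible A b C X' y' w'" for X' y' w'
  proof (cases "w' \<le> s")
    case True
    then show ?thesis using that by (intro min[of X']) (simp add: F_def aux_feasible_def)
  next
    case False
    then show ?thesis using Xw by (simp add: F_def)
  qed
  ultimately show ?thesis by (auto simp: aux_optimal_def)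
qed

section \<open>Multipliers for the auxiliary problem by separation\<close>

lemma aux_strict_infeasible:
  assumes "aux_optimal A b C X0 y0 w0" "0 < w0"
    and "\<And>i. sym_mat (A i)" "sym_mat C"
    and "psd X" "nonneg_vec y" "w < w0"
    and "\<And>z. 0 \<le> z \<bullet> ((C + w *\<^sub>R mat 1 - lin_comb A y) *v z)"
    and "\<And>i. 0 \<le> trace_inner (A i) X + w - b $ i"
    and "0 \<le> b \<bullet> y + w - trace_inner C X"
  shows False
proof -
  \<comment> \<open>Here \<open>w\<close> may be negative. Raising it to \<open>max w 0\<close> only
    relaxes the constraints and, since \<open>w0\<close> is positive, stays below \<open>w0\<close>.
    The separated set can therefore omit the sign condition on \<open>w\<close>.\<close>
  define w' where "w' = max w 0"
  have "psd (C + w *\<^sub>R mat 1 - lin_comb A y)"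
    using assms by (intro psdI sym_mat_diff sym_mat_add sym_mat_scaleR sym_lin_comb sym_mat_mat)
  moreover have "psd (mat (w' - w))" by (rule psd_mat) (simp add: w'_def)
  ultimately have "psd ((C + w *\<^sub>R mat 1 - lin_comb A y) + mat (w' - w))"
    by (rule psd_add)
  also have "(C + w *\<^sub>R mat 1 - lin_comb A y) + mat (w' - w) = C - (lin_comb A y - mat w')"
    unfolding mat_eq_scaleR[of "w' - w"] mat_eq_scaleR[of w'] by (simp add: algebra_simps)
  finally have "psd (C - (lin_comb A y - mat w'))" .
  moreover have "b $ i \<le> trace_inner (A i) X + w'" for i
    using assms(9)[of i] by (simp add: w'_def max_def)
  moreover have "trace_inner C X - b \<bullet> y - w' \<le> 0"
    using assms(10) by (simp add: w'_def max_def)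
  moreover have "0 \<le> w'" by (simp add: w'_def)
  ultimately have "aux_feasible A b C X y w'"
    using assms(5,6) by (simp add: aux_feasible_def loewner_le_def)
  then have "w0 \<le> w'" using assms(1) by (simp add: aux_optimal_def)
  then show False using assms(2,7) by (simp add: w'_def max_def split: if_splits)
qed

lemma convex_combination_mono:
  fixes s t :: real
  assumes "a \<le> c" "a' \<le> c'" "0 \<le> s" "0 \<le> t"
  shows "s * a + t * a' \<le> s * c + t * c'"
  using assms by (intro add_mono mult_left_mono)

text \<open>The set \<open>S\<close> consists of all triples dominated by the residuals of the three
  constraint groups at some \<open>w < w0\<close>. It is convex and misses the origin by optimality
  of \<open>w0\<close>. The free slacks \<open>R\<close>, \<open>h\<close>, \<open>r\<close>
  describe this domination, so that each can later be sent to infinity separately.\<close>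

lemma aux_separation:
  fixes A :: "'m::finite \<Rightarrow> real^'n::finite^'n"
  assumes "aux_optimal A b C X0 y0 w0" "0 < w0"
    and "\<And>i. sym_mat (A i)" "sym_mat C"
  obtains G :: "real^'n^'n" and g :: "real^'m" and q :: real where "(G, g, q) \<noteq> 0"
    and "\<And>X y w R h r. \<lbrakk>psd X; nonneg_vec y; w < w0; \<And>z. 0 \<le> z \<bullet> (R *v z);
        nonneg_vec h; 0 \<le> r\<rbrakk> \<Longrightarrow>
      G \<bullet> (C + w *\<^sub>R mat 1 - lin_comb A y - R) +
      (\<Sum>i\<in>UNIV. g $ i * (trace_inner (A i) X + w - b $ i - h $ i)) +
      q * (b \<bullet> y + w - trace_inner C X - r) \<le> 0"
proof -
  define S :: "((real^'n^'n) \<times> (real^'m) \<times> real) set" where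
    "S = {(Q, v, r). \<exists>X y w. psd X \<and> nonneg_vec y \<and> w < w0 \<and>
      (\<forall>z. z \<bullet> (Q *v z) \<le> z \<bullet> ((C + w *\<^sub>R mat 1 - lin_comb A y) *v z)) \<and>
      (\<forall>i. v $ i \<le> trace_inner (A i) X + w - b $ i) \<and> r \<le> b \<bullet> y + w - trace_inner C X}"
  have S_I: "(Q, v, r) \<in> S" if "psd X" "nonneg_vec y" "w < w0"
      "\<And>z. z \<bullet> (Q *v z) \<le> z \<bullet> ((C + w *\<^sub>R mat 1 - lin_comb A y) *v z)"
      "\<And>i. v $ i \<le> trace_inner (A i) X + w - b $ i" "r \<le> b \<bullet> y + w - trace_inner C X"
    for Q v r X y w
    using that unfolding S_def by blast
  have "0 \<notin> S"
  proof
    assume "0 \<in> S"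
    then obtain X y w where "psd X" "nonneg_vec y" "w < w0"
      "\<And>z. 0 \<le> z \<bullet> ((C + w *\<^sub>R mat 1 - lin_comb A y) *v z)"
      "\<And>i. 0 \<le> trace_inner (A i) X + w - b $ i"
      "0 \<le> b \<bullet> y + w - trace_inner C X"
      unfolding S_def zero_prod_def by auto
    then show False by (rule aux_strict_infeasible[OF assms])
  qed
  moreover have "convex S"
  proof (rule convexI)
    fix p p' and s t :: real
    assume "p \<in> S" "p' \<in> S" and st: "0 \<le> s" "0 \<le> t" "s + t = 1"
    obtain Q v r where p: "p = (Q, v, r)" by (cases p) auto
    obtain Q' v' r' where p': "p' = (Q', v', r')" by (cases p') auto
    from \<open>p \<in> S\<close> obtain X y w where 1: "psd X" "nonneg_vec y" "w < w0"
      "\<And>z. z \<bullet> (Q *v z) \<le> z \<bullet> ((C + w *\<^sub>R mat 1 - lin_comb A y) *v z)"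
      "\<And>i. v $ i \<le> trace_inner (A i) X + w - b $ i" "r \<le> b \<bullet> y + w - trace_inner C X"
      unfolding S_def p by auto
    from \<open>p' \<in> S\<close> obtain X' y' w' where 2: "psd X'" "nonneg_vec y'" "w' < w0"
      "\<And>z. z \<bullet> (Q' *v z) \<le> z \<bullet> ((C + w' *\<^sub>R mat 1 - lin_comb A y') *v z)"
      "\<And>i. v' $ i \<le> trace_inner (A i) X' + w' - b $ i" "r' \<le> b \<bullet> y' + w' - trace_inner C X'"
      unfolding S_def p' by auto
    \<comment> \<open>The constants \<open>C\<close> and \<open>b\<close> enter with total weight
      \<open>s + t\<close>; eliminating \<open>t\<close> lets them recombine.\<close>
    have t: "t = 1 - s" using st by simp
    have "(s *\<^sub>R Q + t *\<^sub>R Q', s *\<^sub>R v + t *\<^sub>R v', s * r + t * r') \<in> S"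
    proof (rule S_I[of "s *\<^sub>R X + t *\<^sub>R X'" "s *\<^sub>R y + t *\<^sub>R y'" "s * w + t * w'"])
      show "psd (s *\<^sub>R X + t *\<^sub>R X')" using 1 2 st by (intro psd_add psd_scaleR)
      show "nonneg_vec (s *\<^sub>R y + t *\<^sub>R y')" using 1 2 st by (simp add: nonneg_vec_def)
      show "s * w + t * w' < w0" using 1 2 st by (intro convex_bound_lt) auto
    next
      fix z
      from convex_combination_mono[OF 1(4)[of z] 2(4)[of z] st(1,2)]
      show "z \<bullet> ((s *\<^sub>R Q + t *\<^sub>R Q') *v z) \<le> z \<bullet>
        ((C + (s * w + t * w') *\<^sub>R mat 1 - lin_comb A (s *\<^sub>R y + t *\<^sub>R y')) *v z)"
        unfolding quad_form_eq_inner t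
        by (simp add: inner_add_right inner_diff_right lin_comb_add lin_comb_scaleR)
          (simp add: algebra_simps)
    next
      fix i
      from convex_combination_mono[OF 1(5)[of i] 2(5)[of i] st(1,2)]
      show "(s *\<^sub>R v + t *\<^sub>R v') $ i \<le>
        trace_inner (A i) (s *\<^sub>R X + t *\<^sub>R X') + (s * w + t * w') - b $ i"
        unfolding t by (simp add: trace_inner_simps algebra_simps)
    next
      from convex_combination_mono[OF 1(6) 2(6) st(1,2)]
      show "s * r + t * r' \<le> b \<bullet> (s *\<^sub>R y + t *\<^sub>R y') + (s * w + t * w') -
          trace_inner C (s *\<^sub>R X + t *\<^sub>R X')"
        unfolding t by (simp add: trace_inner_simps inner_add_right algebra_simps)
    qed
    then show "s *\<^sub>R p + t *\<^sub>R p' \<in> S" by (simp add: p p')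
  qed
  ultimately obtain a where a: "a \<noteq> 0" "\<And>x. x \<in> S \<Longrightarrow> 0 \<le> a \<bullet> x"
    using separating_hyperplane_set_0[of S] by auto
  \<comment> \<open>The hyperplane theorem gives a functional that is nonnegative on
    \<open>S\<close>; its negative is the multiplier.\<close>
  obtain G g q where aG: "- a = (G, g, q)" by (cases "- a") auto
  show ?thesis
  proof (rule that[of G g q])
    show "(G, g, q) \<noteq> 0" using a(1) aG by (metis neg_equal_0_iff_equal)
  next
    fix X R :: "real^'n^'n" and y h :: "real^'m" and w r :: real
    assume *: "psd X" "nonneg_vec y" "w < w0" "\<And>z. 0 \<le> z \<bullet> (R *v z)" "nonneg_vec h" "0 \<le> r"
    have "(C + w *\<^sub>R mat 1 - lin_comb A y - R,
        (\<chi> i. trace_inner (A i) X + w - b $ i - h $ i), b \<bullet> y + w - trace_inner C X - r) \<in> S"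
    proof (rule S_I[OF *(1-3)])
      fix z
      show "z \<bullet> ((C + w *\<^sub>R mat 1 - lin_comb A y - R) *v z) \<le>
          z \<bullet> ((C + w *\<^sub>R mat 1 - lin_comb A y) *v z)"
        using *(4)[of z] by (simp add: quad_form_eq_inner inner_diff_right)
    qed (use *(5,6) in \<open>auto simp: nonneg_vec_def\<close>)
    from a(2)[OF this] have "- a \<bullet> (C + w *\<^sub>R mat 1 - lin_comb A y - R,
        (\<chi> i. trace_inner (A i) X + w - b $ i - h $ i), b \<bullet> y + w - trace_inner C X - r) \<le> 0"
      by simp
    then show "G \<bullet> (C + w *\<^sub>R mat 1 - lin_comb A y - R) +
      (\<Sum>i\<in>UNIV. g $ i * (trace_inner (A i) X + w - b $ i - h $ i)) +
      q * (b \<bullet> y + w - trace_inner C X - r) \<le> 0"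
      unfolding aG by (simp add: inner_vec_def[of g] add.assoc)
  qed
qed

text \<open>Every property comes from the separation inequality along one ray: the slacks give the
  signs of \<open>G\<close>, \<open>g\<close>, \<open>q\<close>, while \<open>y\<close> along a unit
  vector and \<open>X\<close> along a rank-one matrix give the two homogenised constraints. Letting
  \<open>w\<close> tend to \<open>w0\<close> gives the gap, and division by the total weight
  normalises.\<close>

lemma aux_dual_certificate:
  fixes A :: "'m::finite \<Rightarrow> real^'n::finite^'n"
  assumes "aux_optimal A b C X0 y0 w0" "0 < w0"
    and "\<And>i. sym_mat (A i)" "sym_mat C"
  obtains G g q where "psd G" "nonneg_vec g" "0 \<le> q" "trace G + (\<Sum>i\<in>UNIV. g $ i) + q = 1"
    and "\<And>i. q * b $ i \<le> trace_inner (A i) G" "psd (q *\<^sub>R C - lin_comb A g)"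
    and "w0 \<le> b \<bullet> g - trace_inner C G"
proof (rule aux_separation[OF assms])
  fix G :: "real^'n^'n" and g :: "real^'m" and q :: real
  assume nz: "(G, g, q) \<noteq> 0"
    and key: "\<And>X y w R h r. \<lbrakk>psd X; nonneg_vec y; w < w0; \<And>z. 0 \<le> z \<bullet> (R *v z);
        nonneg_vec h; 0 \<le> r\<rbrakk> \<Longrightarrow>
      G \<bullet> (C + w *\<^sub>R mat 1 - lin_comb A y - R) +
      (\<Sum>i\<in>UNIV. g $ i * (trace_inner (A i) X + w - b $ i - h $ i)) +
      q * (b \<bullet> y + w - trace_inner C X - r) \<le> 0"
  \<comment> \<open>The value of the inequality at \<open>X = 0\<close>, \<open>y = 0\<close> and
    zero slacks, which is the constant term along each ray.\<close>
  define c where "c w = G \<bullet> (C + w *\<^sub>R mat 1) + (\<Sum>i\<in>UNIV. g $ i * (w - b $ i)) + q * w" for w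
  have nn0: "nonneg_vec (0 :: real^'m)" by (simp add: nonneg_vec_def)
  have nna: "nonneg_vec (k *\<^sub>R axis i 1 :: real^'m)" if "0 \<le> k" for k i
    using that by (simp add: nonneg_vec_def axis_def)
  have w1: "w0 - 1 < w0" by simp
  have psdG: "psd G"
  proof (rule psd_of_inner_nonneg)
    fix R :: "real^'n^'n" assume R: "\<And>z. 0 \<le> z \<bullet> (R *v z)"
    have "c (w0 - 1) + k * - (G \<bullet> R) \<le> 0" if "0 \<le> k" for k
      using key[OF psd_zero nn0 w1 _ nn0 order_refl, of "k *\<^sub>R R"] R that
      by (simp add: c_def quad_form_eq_inner trace_inner_simps lin_comb_zero inner_diff_right)
    then have "- (G \<bullet> R) \<le> 0" by (rule affine_bounded_imp_slope_nonpos)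
    then show "0 \<le> G \<bullet> R" by simp
  qed
  have G: "G \<bullet> P = trace_inner P G" for P
    by (simp add: trace_inner_commute[of P] sym_trace_inner psd_symD[OF psdG])
  have g: "nonneg_vec g"
    unfolding nonneg_vec_def
  proof
    fix i
    have "c (w0 - 1) + k * - (g $ i) \<le> 0" if "0 \<le> k" for k
    proof -
      have "(\<Sum>j\<in>UNIV. g $ j * (k *\<^sub>R axis i 1 :: real^'m) $ j) = k * g $ i"
        by (simp add: axis_def if_distrib cong: if_cong)
      then show ?thesis
        using key[OF psd_zero nn0 w1 _ nna[OF that, of i] order_refl, of 0]
        by (simp add: c_def trace_inner_simps lin_comb_zero right_diff_distrib sum_subtractf
            del: vector_scaleR_component)
    qed
    then have "- (g $ i) \<le> 0" by (rule affine_bounded_imp_slope_nonpos)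
    then show "0 \<le> g $ i" by simp
  qed
  have q: "0 \<le> q"
  proof -
    have "c (w0 - 1) + k * - q \<le> 0" if "0 \<le> k" for k
      using key[OF psd_zero nn0 w1 _ nn0 that, of 0]
      by (simp add: c_def trace_inner_simps lin_comb_zero algebra_simps)
    then have "- q \<le> 0" by (rule affine_bounded_imp_slope_nonpos)
    then show ?thesis by simp
  qed
  have AG: "q * b $ i \<le> trace_inner (A i) G" for i
  proof -
    have "c (w0 - 1) + k * (q * b $ i - trace_inner (A i) G) \<le> 0" if "0 \<le> k" for k
      using key[OF psd_zero nna[OF that, of i] w1 _ nn0 order_refl, of 0]
      by (simp add: c_def trace_inner_simps lin_comb_scaleR lin_comb_axis inner_diff_right
          inner_axis G[of "A i"] algebra_simps)
    from affine_bounded_imp_slope_nonpos[OF this] show ?thesis by simp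
  qed
  have Cg: "psd (q *\<^sub>R C - lin_comb A g)"
  proof (rule psdI)
    show "sym_mat (q *\<^sub>R C - lin_comb A g)"
      by (intro sym_mat_diff sym_mat_scaleR sym_lin_comb assms)
    fix z :: "real^'n"
    have "c (w0 - 1) + k * - (z \<bullet> ((q *\<^sub>R C - lin_comb A g) *v z)) \<le> 0" if "0 \<le> k" for k
    proof -
      have "z \<bullet> ((q *\<^sub>R C - lin_comb A g) *v z) =
          q * trace_inner C (outer z) - (\<Sum>i\<in>UNIV. g $ i * trace_inner (A i) (outer z))"
        unfolding trace_inner_outer[symmetric] trace_inner_commute[of "outer z"]
        by (simp add: trace_inner_simps trace_inner_lin_comb)
      moreover have "(\<Sum>i\<in>UNIV. g $ i * (trace_inner (A i) (k *\<^sub>R outer z) + (w0 - 1) - b $ i - 0)) =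
          (\<Sum>i\<in>UNIV. g $ i * (w0 - 1 - b $ i)) + k * (\<Sum>i\<in>UNIV. g $ i * trace_inner (A i) (outer z))"
        by (simp add: trace_inner_simps sum_distrib_left sum.distrib[symmetric] algebra_simps)
      ultimately show ?thesis
        using key[OF psd_scaleR[OF psd_outer that, of z] nn0 w1 _ nn0 order_refl, of 0]
        by (simp add: c_def trace_inner_scaleR_right lin_comb_zero) (simp add: algebra_simps)
    qed
    from affine_bounded_imp_slope_nonpos[OF this]
    show "0 \<le> z \<bullet> ((q *\<^sub>R C - lin_comb A g) *v z)" by simp
  qed
  \<comment> \<open>\<open>N\<close> is both the normalising weight and the slope of
    \<open>c\<close>. It is positive because a positive semidefinite matrix of trace zero vanishes
    and the multiplier is nonzero.\<close>
  define N where "N = trace G + (\<Sum>i\<in>UNIV. g $ i) + q"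
  have g_nonneg: "0 \<le> g $ i" for i using g by (simp add: nonneg_vec_def)
  have N_parts: "0 \<le> trace G" "0 \<le> (\<Sum>i\<in>UNIV. g $ i)"
    using psd_trace_nonneg[OF psdG] g_nonneg by (simp_all add: sum_nonneg)
  have "N \<noteq> 0"
  proof
    assume "N = 0"
    then have z: "trace G = 0" "(\<Sum>i\<in>UNIV. g $ i) = 0" "q = 0"
      using N_parts q by (simp_all add: N_def)
    then have "G = 0" using psd_norm_le_trace[OF psdG] by simp
    moreover have "g = 0"
      using z(2) g_nonneg by (simp add: sum_nonneg_eq_0_iff vec_eq_iff)
    ultimately show False using nz z(3) by (simp add: zero_prod_def)
  qed
  then have N: "0 < N" using N_parts q by (simp add: N_def)
  have cw: "c w = trace_inner C G - b \<bullet> g + w * N" for w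
  proof -
    have "G \<bullet> mat 1 = trace G"
      using trace_inner_mat[of G 1] by (simp add: sym_trace_inner psd_symD[OF psdG])
    then show ?thesis
      by (simp add: c_def G[of C] inner_add_right N_def inner_vec_def[of b] right_diff_distrib
          sum_subtractf sum_distrib_left[symmetric] sum_distrib_right[symmetric] algebra_simps)
  qed
  have "c w0 \<le> 0"
  proof (rule field_le_epsilon)
    fix e :: real assume "0 < e"
    \<comment> \<open>The inequality is available only strictly below \<open>w0\<close>. A decrement
      of \<open>e / N\<close> costs exactly \<open>e\<close>, so the bound passes to the
      limit.\<close>
    have "c (w0 - e / N) \<le> 0"
      using key[OF psd_zero nn0 _ _ nn0 order_refl, of "w0 - e / N" 0] \<open>0 < e\<close> N
      by (simp add: c_def trace_inner_simps lin_comb_zero)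
    then show "c w0 \<le> 0 + e" using N by (simp add: cw left_diff_distrib)
  qed
  then have final: "w0 * N \<le> b \<bullet> g - trace_inner C G" by (simp add: cw)
  show ?thesis
  proof (rule that[of "(1 / N) *\<^sub>R G" "(1 / N) *\<^sub>R g" "q / N"])
    show "psd ((1 / N) *\<^sub>R G)" using N by (intro psd_scaleR psdG) simp
    show "nonneg_vec ((1 / N) *\<^sub>R g)" using g N by (simp add: nonneg_vec_def)
    show "0 \<le> q / N" using q N by simp
    show "trace ((1 / N) *\<^sub>R G) + (\<Sum>i\<in>UNIV. ((1 / N) *\<^sub>R g) $ i) + q / N = 1"
    proof -
      have "trace ((1 / N) *\<^sub>R G) = trace G / N"
        by (simp add: trace_def sum_divide_distrib)
      moreover have "(\<Sum>i\<in>UNIV. ((1 / N) *\<^sub>R g) $ i) = (\<Sum>i\<in>UNIV. g $ i) / N"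
        by (simp add: sum_divide_distrib)
      ultimately show ?thesis using N by (simp add: add_divide_distrib[symmetric] N_def)
    qed
    show "q / N * b $ i \<le> trace_inner (A i) ((1 / N) *\<^sub>R G)" for i
      using AG[of i] N by (simp add: trace_inner_simps divide_right_mono)
    have "(q / N) *\<^sub>R C - lin_comb A ((1 / N) *\<^sub>R g) = (1 / N) *\<^sub>R (q *\<^sub>R C - lin_comb A g)"
      by (simp add: lin_comb_scaleR scaleR_diff_right)
    then show "psd ((q / N) *\<^sub>R C - lin_comb A ((1 / N) *\<^sub>R g))"
      using N by (simp only:) (intro psd_scaleR Cg, simp)
    show "w0 \<le> b \<bullet> ((1 / N) *\<^sub>R g) - trace_inner C ((1 / N) *\<^sub>R G)"
      using final N by (simp add: trace_inner_simps field_simps)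
  qed
qed

section \<open>The game\<close>

lemma block1_dsum [simp]: "block1 (P \<oplus>\<^sub>D Q) = P"
  and block2_dsum [simp]: "block2 (P \<oplus>\<^sub>D Q) = Q"
  by (simp_all add: block1_def block2_def dsum_def vec_eq_iff)

lemma diag_vec_diag_mat [simp]: "diag_vec (diag_mat y) = y"
  by (simp add: diag_vec_def diag_mat_def vec_eq_iff)

lemma diag_mat_inject [simp]: "diag_mat x = diag_mat y \<longleftrightarrow> x = y"
  by (metis diag_vec_diag_mat)

lemma mat1_inject [simp]: "(mat s :: real^1^1) = mat t \<longleftrightarrow> s = t"
  by (simp add: mat_def vec_eq_iff)

lemma dsum_inject [simp]: "P \<oplus>\<^sub>D Q = P' \<oplus>\<^sub>D Q' \<longleftrightarrow> P = P' \<and> Q = Q'"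
  by (metis block1_dsum block2_dsum)

lemma diag1_in_strategies1:
  "diag1 X y t u \<in> strategies1 \<longleftrightarrow> psd X \<and> nonneg_vec y \<and> 0 \<le> t \<and> 0 \<le> u \<and>
    trace X + (\<Sum>i\<in>UNIV. y $ i) + t + u = 1"
  unfolding strategies1_def mem_Collect_eq
  by (simp add: trace_diag1) (auto simp: diag1_def)

lemma diag2_in_strategies2:
  "diag2 X y t \<in> strategies2 \<longleftrightarrow> psd X \<and> nonneg_vec y \<and> 0 \<le> t \<and>
    trace X + (\<Sum>i\<in>UNIV. y $ i) + t = 1"
  unfolding strategies2_def mem_Collect_eq
  by (simp add: trace_diag2) (auto simp: diag2_def)

lemma strategies1_cases:
  assumes "Z \<in> strategies1"
  obtains X y t u where "Z = diag1 X y t u" "psd X" "nonneg_vec y" "0 \<le> t" "0 \<le> u"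
    "trace X + (\<Sum>i\<in>UNIV. y $ i) + t + u = 1"
  using assms by (auto simp: strategies1_def trace_diag1)

lemma strategies2_cases:
  assumes "Z \<in> strategies2"
  obtains X y t where "Z = diag2 X y t" "psd X" "nonneg_vec y" "0 \<le> t"
    "trace X + (\<Sum>i\<in>UNIV. y $ i) + t = 1"
  using assms by (auto simp: strategies2_def trace_diag2)

section \<open>Boundedness of the payoff\<close>

lemma psd_trace_inner_bound:
  assumes "psd X" "trace X \<le> 1"
  shows "\<bar>trace_inner B X\<bar> \<le> norm B"
proof -
  have "\<bar>X \<bullet> B\<bar> \<le> norm X * norm B" by (rule Cauchy_Schwarz_ineq2)
  also have "\<dots> \<le> 1 * norm B"
    using psd_norm_le_trace[OF assms(1)] assms(2) by (intro mult_right_mono) auto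
  finally show ?thesis
    by (simp add: trace_inner_commute[of B] sym_trace_inner psd_symD[OF assms(1)])
qed

lemma abs_mult_le_of_le_one:
  fixes a c :: real
  assumes "0 \<le> a" "a \<le> 1" "\<bar>c\<bar> \<le> k"
  shows "\<bar>a * c\<bar> \<le> k"
  using mult_left_le_one_le[of "\<bar>c\<bar>" a] assms by (simp add: abs_mult)

lemma nonneg_vec_component_le_sum: "nonneg_vec y \<Longrightarrow> y $ i \<le> (\<Sum>i\<in>UNIV. y $ i)"
  by (rule member_le_sum) (auto simp: nonneg_vec_def)

text \<open>The real infimum and supremum defining guarantee and value obey their order laws only on
  bounded sets. Unit trace bounds every block of a strategy by 1, so each term is bounded by the
  data.\<close>

lemma payoff_bounded:
  fixes A :: "'m::finite \<Rightarrow> real^'n::finite^'n"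
  obtains B where "\<And>Z1 Z2. Z1 \<in> strategies1 \<Longrightarrow> Z2 \<in> strategies2 \<Longrightarrow>
    \<bar>dantzig_payoff A b C M Z1 Z2\<bar> \<le> B"
proof
  fix Z1 :: "('n, 'm) mat1" and Z2 :: "('n, 'm) mat2"
  assume "Z1 \<in> strategies1" "Z2 \<in> strategies2"
  from this(1) obtain X y t u where Z1: "Z1 = diag1 X y t u" and
    1: "psd X" "nonneg_vec y" "0 \<le> t" "0 \<le> u" "trace X + (\<Sum>i\<in>UNIV. y $ i) + t + u = 1"
    by (rule strategies1_cases)
  from \<open>Z2 \<in> strategies2\<close> obtain X' y' t' where Z2: "Z2 = diag2 X' y' t'" and
    2: "psd X'" "nonneg_vec y'" "0 \<le> t'" "trace X' + (\<Sum>i\<in>UNIV. y' $ i) + t' = 1"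
    by (rule strategies2_cases)
  have y: "0 \<le> y $ i" and y': "0 \<le> y' $ i" for i
    using 1(2) 2(2) by (simp_all add: nonneg_vec_def)
  have s: "0 \<le> (\<Sum>i\<in>UNIV. y $ i)" "0 \<le> (\<Sum>i\<in>UNIV. y' $ i)"
    by (simp_all add: sum_nonneg y y')
  have le: "trace X \<le> 1" "(\<Sum>i\<in>UNIV. y $ i) \<le> 1" "t \<le> 1" "u \<le> 1"
    "trace X' \<le> 1" "(\<Sum>i\<in>UNIV. y' $ i) \<le> 1" "t' \<le> 1"
    using 1 2 s psd_trace_nonneg[OF 1(1)] psd_trace_nonneg[OF 2(1)] by linarith+
  have yi: "y $ i \<le> 1" and yi': "y' $ i \<le> 1" for i
    using nonneg_vec_component_le_sum[OF 1(2), of i] nonneg_vec_component_le_sum[OF 2(2), of i] le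
    by linarith+
  have "\<bar>\<Sum>i\<in>UNIV. y $ i * (t' * b $ i - trace_inner (A i) X')\<bar> \<le>
      (\<Sum>i\<in>UNIV. \<bar>b $ i\<bar> + norm (A i))"
  proof (rule order_trans[OF sum_abs], rule sum_mono, rule abs_mult_le_of_le_one[OF y yi])
    fix i
    show "\<bar>t' * b $ i - trace_inner (A i) X'\<bar> \<le> \<bar>b $ i\<bar> + norm (A i)"
      using abs_mult_le_of_le_one[OF 2(3) le(7) order_refl, of "b $ i"]
        psd_trace_inner_bound[OF 2(1) le(5), of "A i"] by linarith
  qed
  moreover have "\<bar>trace_inner X (lin_comb A y' - t' *\<^sub>R C)\<bar> \<le> (\<Sum>i\<in>UNIV. norm (A i)) + norm C"
  proof -
    have "\<bar>\<Sum>i\<in>UNIV. y' $ i * trace_inner (A i) X\<bar> \<le> (\<Sum>i\<in>UNIV. norm (A i))"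
      by (rule order_trans[OF sum_abs], rule sum_mono,
          rule abs_mult_le_of_le_one[OF y' yi' psd_trace_inner_bound[OF 1(1) le(1)]])
    moreover have "\<bar>t' * trace_inner C X\<bar> \<le> norm C"
      by (rule abs_mult_le_of_le_one[OF 2(3) le(7) psd_trace_inner_bound[OF 1(1) le(1)]])
    ultimately show ?thesis
      by (simp add: trace_inner_commute[of X] trace_inner_diff_left trace_inner_scaleR_left
          trace_inner_lin_comb)
  qed
  moreover have "\<bar>t * (trace_inner C X' - b \<bullet> y')\<bar> \<le> norm C + (\<Sum>i\<in>UNIV. \<bar>b $ i\<bar>)"
  proof (rule abs_mult_le_of_le_one[OF 1(3) le(3)])
    have "\<bar>\<Sum>i\<in>UNIV. y' $ i * b $ i\<bar> \<le> (\<Sum>i\<in>UNIV. \<bar>b $ i\<bar>)"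
      by (rule order_trans[OF sum_abs], rule sum_mono,
          rule abs_mult_le_of_le_one[OF y' yi' order_refl])
    then show "\<bar>trace_inner C X' - b \<bullet> y'\<bar> \<le> norm C + (\<Sum>i\<in>UNIV. \<bar>b $ i\<bar>)"
      using psd_trace_inner_bound[OF 2(1) le(5), of C] by (simp add: inner_vec_def mult.commute)
  qed
  moreover have "\<bar>u * (trace X' + (\<Sum>i\<in>UNIV. y' $ i) - t' * M)\<bar> \<le> 1 + \<bar>M\<bar>"
  proof (rule abs_mult_le_of_le_one[OF 1(4) le(4)])
    show "\<bar>trace X' + (\<Sum>i\<in>UNIV. y' $ i) - t' * M\<bar> \<le> 1 + \<bar>M\<bar>"
      using abs_mult_le_of_le_one[OF 2(3) le(7) order_refl, of M] 2(3,4)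
        psd_trace_nonneg[OF 2(1)] s by linarith
  qed
  ultimately show "\<bar>dantzig_payoff A b C M Z1 Z2\<bar> \<le> (\<Sum>i\<in>UNIV. \<bar>b $ i\<bar> + norm (A i)) +
      ((\<Sum>i\<in>UNIV. norm (A i)) + norm C) + (norm C + (\<Sum>i\<in>UNIV. \<bar>b $ i\<bar>)) + (1 + \<bar>M\<bar>)"
    unfolding Z1 Z2 dantzig_payoff_diag by linarith
qed

text \<open>Collecting terms by the blocks of the second player exposes three coefficients. A
  guarantee of the first player is a lower bound on each of them, in the Loewner order for the
  matrix block.\<close>

lemma dantzig_payoff_linear2:
  "dantzig_payoff A b C M (diag1 X y t u) (diag2 X' y' t') =
    trace_inner (t *\<^sub>R C - lin_comb A y + u *\<^sub>R mat 1) X' +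
    (\<Sum>i\<in>UNIV. y' $ i * (trace_inner (A i) X - t * b $ i + u)) +
    t' * (b \<bullet> y - trace_inner C X - u * M)"
proof -
  have "(\<Sum>i\<in>UNIV. y' $ i * (trace_inner (A i) X - t * b $ i + u)) =
      trace_inner (lin_comb A y') X - t * (b \<bullet> y') + u * (\<Sum>i\<in>UNIV. y' $ i)"
    by (simp add: trace_inner_lin_comb inner_vec_def sum_distrib_left sum.distrib sum_subtractf
        algebra_simps)
  moreover have "(\<Sum>i\<in>UNIV. y $ i * (t' * b $ i - trace_inner (A i) X')) =
      t' * (b \<bullet> y) - trace_inner (lin_comb A y) X'"
    by (simp add: trace_inner_lin_comb inner_vec_def sum_distrib_left sum_subtractf algebra_simps)
  ultimately show ?thesis
    unfolding dantzig_payoff_diag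
    by (simp add: trace_inner_add_left trace_inner_diff_left trace_inner_scaleR_left
        trace_inner_mat_left trace_inner_commute[of X]) (simp add: algebra_simps)
qed

section \<open>Guarantees of the first player and the value of the game\<close>

lemma strategies2_nonempty: "strategies2 \<noteq> ({} :: ('n::finite, 'm::finite) mat2 set)"
proof -
  have "(diag2 0 0 1 :: ('n, 'm) mat2) \<in> strategies2"
    by (simp add: diag2_in_strategies2 psd_zero nonneg_vec_def trace_def)
  then show ?thesis by blast
qed

lemma guaranteed_payoff_le:
  assumes "Z1 \<in> strategies1" "Z2 \<in> strategies2"
  shows "guaranteed_payoff strategies2 (dantzig_payoff A b C M) Z1 \<le> dantzig_payoff A b C M Z1 Z2"
proof -
  obtain B where B: "\<And>Z1 Z2. Z1 \<in> strategies1 \<Longrightarrow> Z2 \<in> strategies2 \<Longrightarrow>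
    \<bar>dantzig_payoff A b C M Z1 Z2\<bar> \<le> B" using payoff_bounded by blast
  show ?thesis
    unfolding guaranteed_payoff_def
  proof (rule cINF_lower[OF _ assms(2)])
    show "bdd_below (dantzig_payoff A b C M Z1 ` strategies2)"
      using B[OF assms(1)] by (intro bdd_belowI2[of _ "- B"]) (metis abs_le_iff minus_le_iff)
  qed
qed

text \<open>If every coefficient is at least \<open>s\<close>, then so is the payoff, since the
  blocks of the second player have total weight 1.\<close>

lemma dantzig_value_ge:
  fixes A :: "'m::finite \<Rightarrow> real^'n::finite^'n"
  assumes "psd X" "nonneg_vec y" "0 \<le> t" "0 \<le> u" "trace X + (\<Sum>i\<in>UNIV. y $ i) + t + u = 1"
    and "psd (t *\<^sub>R C - lin_comb A y + (u - s) *\<^sub>R mat 1)"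
    and "\<And>i. s \<le> trace_inner (A i) X - t * b $ i + u"
    and "s \<le> b \<bullet> y - trace_inner C X - u * M"
  shows "s \<le> dantzig_value A b C M"
proof -
  obtain B where B: "\<And>Z1 Z2. Z1 \<in> strategies1 \<Longrightarrow> Z2 \<in> strategies2 \<Longrightarrow>
    \<bar>dantzig_payoff A b C M Z1 Z2\<bar> \<le> B" using payoff_bounded by blast
  have Z: "diag1 X y t u \<in> strategies1" using assms by (simp add: diag1_in_strategies1)
  have "s \<le> dantzig_payoff A b C M (diag1 X y t u) Z2" if "Z2 \<in> strategies2" for Z2
  proof -
    from that obtain X' y' t' where Z2: "Z2 = diag2 X' y' t'" and
      2: "psd X'" "nonneg_vec y'" "0 \<le> t'" "trace X' + (\<Sum>i\<in>UNIV. y' $ i) + t' = 1"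
      by (rule strategies2_cases)
    have "0 \<le> trace_inner (t *\<^sub>R C - lin_comb A y + (u - s) *\<^sub>R mat 1) X'"
      by (rule psd_trace_inner_nonneg[OF assms(6) 2(1)])
    then have "s * trace X' \<le> trace_inner (t *\<^sub>R C - lin_comb A y + u *\<^sub>R mat 1) X'"
      by (simp add: trace_inner_simps trace_inner_mat_left left_diff_distrib)
    moreover have "s * (\<Sum>i\<in>UNIV. y' $ i) \<le> (\<Sum>i\<in>UNIV. y' $ i * (trace_inner (A i) X - t * b $ i + u))"
      unfolding sum_distrib_left using 2(2) assms(7)
      by (intro sum_mono) (simp add: mult.commute[of s] mult_left_mono nonneg_vec_def)
    moreover have "s * t' \<le> t' * (b \<bullet> y - trace_inner C X - u * M)"
      using 2(3) assms(8) by (simp add: mult.commute[of s] mult_left_mono)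
    moreover have "s = s * trace X' + s * (\<Sum>i\<in>UNIV. y' $ i) + s * t'"
      using 2(4) by (simp add: distrib_left[symmetric])
    ultimately show ?thesis unfolding Z2 dantzig_payoff_linear2 by linarith
  qed
  then have "s \<le> guaranteed_payoff strategies2 (dantzig_payoff A b C M) (diag1 X y t u)"
    unfolding guaranteed_payoff_def by (intro cINF_greatest strategies2_nonempty)
  also have "\<dots> \<le> dantzig_value A b C M"
    unfolding dantzig_value_def game_value_def
  proof (rule cSUP_upper[OF Z], rule bdd_aboveI2)
    fix Z1 :: "('n, 'm) mat1"
    assume Z1: "Z1 \<in> strategies1"
    obtain Z2 :: "('n, 'm) mat2" where Z2: "Z2 \<in> strategies2" using strategies2_nonempty by blast
    from guaranteed_payoff_le[OF Z1 Z2] B[OF Z1 Z2]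
    show "guaranteed_payoff strategies2 (dantzig_payoff A b C M) Z1 \<le> B"
      by (metis abs_le_D1 order_trans)
  qed
  finally show ?thesis .
qed

text \<open>Each coefficient bound comes from a pure answer: a unit vector, the last scalar block,
  or a rank-one matrix scaled to trace 1.\<close>

lemma dantzig_optimal1D:
  fixes A :: "'m::finite \<Rightarrow> real^'n::finite^'n"
  assumes "dantzig_optimal1 A b C M (diag1 X y t u)"
    and "\<And>i. sym_mat (A i)" "sym_mat C" and v: "v = dantzig_value A b C M"
  shows "psd X" "nonneg_vec y" "0 \<le> t" "0 \<le> u" "trace X + (\<Sum>i\<in>UNIV. y $ i) + t + u = 1"
    and "psd (t *\<^sub>R C - lin_comb A y + (u - v) *\<^sub>R mat 1)"
    and "v \<le> trace_inner (A i) X - t * b $ i + u"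
    and "v \<le> b \<bullet> y - trace_inner C X - u * M"
proof -
  have Z: "diag1 X y t u \<in> strategies1"
    and opt: "guaranteed_payoff strategies2 (dantzig_payoff A b C M) (diag1 X y t u) = v"
    using assms(1) by (simp_all add: dantzig_optimal1_def optimal_strategy1_def v dantzig_value_def)
  then show "psd X" "nonneg_vec y" "0 \<le> t" "0 \<le> u" "trace X + (\<Sum>i\<in>UNIV. y $ i) + t + u = 1"
    by (simp_all add: diag1_in_strategies1)
  have le: "v \<le> dantzig_payoff A b C M (diag1 X y t u) Z2" if "Z2 \<in> strategies2" for Z2
    using guaranteed_payoff_le[OF Z that, of A b C M] opt by simp
  have "(diag2 0 (axis i 1) 0 :: ('n, 'm) mat2) \<in> strategies2"
    by (simp add: diag2_in_strategies2 psd_zero nonneg_vec_def axis_def trace_def)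
  from le[OF this] show "v \<le> trace_inner (A i) X - t * b $ i + u"
    by (simp add: dantzig_payoff_linear2 trace_inner_zero_right axis_def if_distrib[of "\<lambda>x. x * _"]
        cong: if_cong)
  have "(diag2 0 0 1 :: ('n, 'm) mat2) \<in> strategies2"
    by (simp add: diag2_in_strategies2 psd_zero nonneg_vec_def trace_def)
  from le[OF this] show "v \<le> b \<bullet> y - trace_inner C X - u * M"
    by (simp add: dantzig_payoff_linear2 trace_inner_zero_right)
  show "psd (t *\<^sub>R C - lin_comb A y + (u - v) *\<^sub>R mat 1)"
  proof (rule psdI)
    show "sym_mat (t *\<^sub>R C - lin_comb A y + (u - v) *\<^sub>R mat 1)"
      by (intro sym_mat_add sym_mat_diff sym_mat_scaleR sym_lin_comb sym_mat_mat assms)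
    fix z :: "real^'n"
    show "0 \<le> z \<bullet> ((t *\<^sub>R C - lin_comb A y + (u - v) *\<^sub>R mat 1) *v z)"
    proof (cases "z = 0")
      case False
      define k where "k = 1 / (z \<bullet> z)"
      have k: "0 < k" using False by (simp add: k_def)
      have tr: "trace (k *\<^sub>R outer z) = 1"
        using trace_inner_mat[of "k *\<^sub>R outer z" 1] trace_inner_mat[of "outer z" 1] False
        by (simp add: trace_inner_scaleR_left trace_outer k_def)
      have "(diag2 (k *\<^sub>R outer z) 0 0 :: ('n, 'm) mat2) \<in> strategies2"
        using k tr by (simp add: diag2_in_strategies2 psd_scaleR psd_outer nonneg_vec_def)
      from le[OF this]
      have "v * trace (k *\<^sub>R outer z) \<le>
          trace_inner (t *\<^sub>R C - lin_comb A y + u *\<^sub>R mat 1) (k *\<^sub>R outer z)"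
        by (simp add: dantzig_payoff_linear2 tr)
      then have "0 \<le> trace_inner (t *\<^sub>R C - lin_comb A y + (u - v) *\<^sub>R mat 1) (k *\<^sub>R outer z)"
        by (simp add: trace_inner_add_left trace_inner_diff_left trace_inner_scaleR_left
            trace_inner_mat_left left_diff_distrib)
      then have "0 \<le> k * (z \<bullet> ((t *\<^sub>R C - lin_comb A y + (u - v) *\<^sub>R mat 1) *v z))"
        by (simp only: trace_inner_scaleR_right trace_inner_commute[of _ "outer z"] trace_inner_outer)
      then show ?thesis using k by (simp add: zero_le_mult_iff)
    qed simp
  qed
qed

lemma dantzig_value_ge_aux:
  fixes A :: "'m::finite \<Rightarrow> real^'n::finite^'n"
  assumes "aux_optimal A b C X0 y0 w" "0 < w" "0 \<le> M"
    and "\<And>i. sym_mat (A i)" "sym_mat C"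
  shows "w / (1 + M + w) \<le> dantzig_value A b C M"
proof (rule aux_dual_certificate[OF assms(1,2,4,5)])
  fix G :: "real^'n^'n" and g :: "real^'m" and q
  assume G: "psd G" "nonneg_vec g" "0 \<le> q" "trace G + (\<Sum>i\<in>UNIV. g $ i) + q = 1"
    and AG: "\<And>i. q * b $ i \<le> trace_inner (A i) G" and Cg: "psd (q *\<^sub>R C - lin_comb A g)"
    and w: "w \<le> b \<bullet> g - trace_inner C G"
  \<comment> \<open>The weight \<open>s\<close> on the last pure strategy solves
    \<open>(1 - s) * w - s * M = s\<close>. The matrix and vector coefficients are then guaranteed
    \<open>s\<close> through \<open>u = s\<close>, and the scalar coefficient is guaranteed the same
    amount.\<close>
  define s where "s = w / (1 + M + w)"
  have pos: "0 < 1 + M + w" using assms by simp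
  have s: "0 \<le> s" "s \<le> 1" using assms pos by (simp_all add: s_def)
  have "s * (1 + M + w) = w" using pos by (simp add: s_def)
  then have eq: "(1 - s) * w - s * M = s" by (simp add: algebra_simps)
  show "w / (1 + M + w) \<le> dantzig_value A b C M"
    unfolding s_def[symmetric]
  proof (rule dantzig_value_ge[of "(1 - s) *\<^sub>R G" "(1 - s) *\<^sub>R g" "(1 - s) * q" s])
    show "psd ((1 - s) *\<^sub>R G)" using s by (intro psd_scaleR G) simp
    show "nonneg_vec ((1 - s) *\<^sub>R g)" using s G(2) by (simp add: nonneg_vec_def)
    show "0 \<le> (1 - s) * q" "0 \<le> s" using s G(3) by simp_all
    have "trace ((1 - s) *\<^sub>R G) = (1 - s) * trace G"
      by (simp add: trace_def sum_distrib_left)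
    moreover have "(\<Sum>i\<in>UNIV. ((1 - s) *\<^sub>R g) $ i) = (1 - s) * (\<Sum>i\<in>UNIV. g $ i)"
      by (simp add: sum_distrib_left)
    moreover have "(1 - s) * trace G + (1 - s) * (\<Sum>i\<in>UNIV. g $ i) + (1 - s) * q = 1 - s"
      using G(4) by (simp add: distrib_left[symmetric])
    ultimately show "trace ((1 - s) *\<^sub>R G) + (\<Sum>i\<in>UNIV. ((1 - s) *\<^sub>R g) $ i) + (1 - s) * q + s = 1"
      by simp
    have "((1 - s) * q) *\<^sub>R C - lin_comb A ((1 - s) *\<^sub>R g) + (s - s) *\<^sub>R mat 1 =
        (1 - s) *\<^sub>R (q *\<^sub>R C - lin_comb A g)"
      by (simp add: lin_comb_scaleR scaleR_diff_right)
    then show "psd (((1 - s) * q) *\<^sub>R C - lin_comb A ((1 - s) *\<^sub>R g) + (s - s) *\<^sub>R mat 1)"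
      using s by (simp only:) (intro psd_scaleR Cg, simp)
    show "s \<le> trace_inner (A i) ((1 - s) *\<^sub>R G) - (1 - s) * q * b $ i + s" for i
      using mult_left_mono[OF AG[of i], of "1 - s"] s by (simp add: trace_inner_scaleR_right mult.assoc)
    have "(1 - s) * w \<le> (1 - s) * (b \<bullet> g - trace_inner C G)"
      using s w by (intro mult_left_mono) simp_all
    then show "s \<le> b \<bullet> ((1 - s) *\<^sub>R g) - trace_inner C ((1 - s) *\<^sub>R G) - s * M"
      using eq by (simp add: trace_inner_scaleR_right right_diff_distrib)
  qed
qed

text \<open>Play \<open>(Xs, ys, 1)\<close> for the second player, with \<open>(Xs, ys)\<close> feasible for the auxiliary
  problem at its optimal value \<open>w\<close>.\<close>

lemma optimal_against_aux_feasible: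
  fixes A :: "'m::finite \<Rightarrow> real^'n::finite^'n"
  assumes X: "psd X" "nonneg_vec y" "0 \<le> t" "trace X + (\<Sum>i\<in>UNIV. y $ i) + t + u = 1"
    and G: "psd (t *\<^sub>R C - lin_comb A y + (u - v) *\<^sub>R mat 1)"
      "\<And>i. v \<le> trace_inner (A i) X - t * b $ i + u"
      "v \<le> b \<bullet> y - trace_inner C X - u * M"
    and aux: "aux_feasible A b C Xs ys w"
    and v: "w \<le> v * (1 + M + w)"
  shows "0 \<le> (u - v) * (trace Xs + (\<Sum>i\<in>UNIV. ys $ i) - (M + w))"
proof -
  have s: "psd Xs" "nonneg_vec ys" "psd (C - (lin_comb A ys - mat w))"
      "\<And>i. b $ i \<le> trace_inner (A i) Xs + w" "trace_inner C Xs - b \<bullet> ys - w \<le> 0"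
    using aux by (simp_all add: aux_feasible_def loewner_le_def)
  \<comment> \<open>Facts 1 and 2 test the guarantees of the strategy against the auxiliary
    solution; 3 and 4 test the auxiliary constraints against the strategy. In their sum the mixed
    terms with \<open>lin_comb\<close> cancel.\<close>
  have 1: "0 \<le> t * trace_inner C Xs - trace_inner (lin_comb A y) Xs + (u - v) * trace Xs"
    using psd_trace_inner_nonneg[OF G(1) s(1)]
    by (simp add: trace_inner_add_left trace_inner_diff_left trace_inner_scaleR_left trace_inner_mat_left)
  have "0 \<le> (\<Sum>i\<in>UNIV. ys $ i * (trace_inner (A i) X - t * b $ i + (u - v)))"
    using G(2) s(2) by (intro sum_nonneg mult_nonneg_nonneg) (auto simp: nonneg_vec_def algebra_simps)
  also have "\<dots> = trace_inner (lin_comb A ys) X - t * (b \<bullet> ys) + (u - v) * (\<Sum>i\<in>UNIV. ys $ i)"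
    by (simp add: trace_inner_lin_comb inner_vec_def sum_distrib_left sum_distrib_right sum.distrib
        sum_subtractf algebra_simps)
  finally have 2: "0 \<le> trace_inner (lin_comb A ys) X - t * (b \<bullet> ys) + (u - v) * (\<Sum>i\<in>UNIV. ys $ i)" .
  have 3: "0 \<le> trace_inner C X - trace_inner (lin_comb A ys) X + w * trace X"
    using psd_trace_inner_nonneg[OF s(3) X(1)] by (simp add: trace_inner_diff_left trace_inner_mat_left)
  have "0 \<le> (\<Sum>i\<in>UNIV. y $ i * (trace_inner (A i) Xs + w - b $ i))"
    using s(4) X(2) by (intro sum_nonneg mult_nonneg_nonneg) (auto simp: nonneg_vec_def algebra_simps)
  also have "\<dots> = trace_inner (lin_comb A y) Xs + w * (\<Sum>i\<in>UNIV. y $ i) - b \<bullet> y"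
    by (simp add: trace_inner_lin_comb inner_vec_def sum_distrib_left sum_distrib_right sum.distrib
        sum_subtractf algebra_simps)
  finally have 4: "0 \<le> trace_inner (lin_comb A y) Xs + w * (\<Sum>i\<in>UNIV. y $ i) - b \<bullet> y" .
  have 5: "t * (trace_inner C Xs - b \<bullet> ys - w) \<le> 0"
    using s(5) X(3) by (rule mult_nonneg_nonpos[rotated])
  have 6: "w * trace X + w * (\<Sum>i\<in>UNIV. y $ i) + w * t + w * u = w"
    using X(4) by (simp add: distrib_left[symmetric])
  \<comment> \<open>After the cancellation, 5 and \<open>G(3)\<close> remove the objective terms, 6
    replaces the weights by \<open>w * (1 - u)\<close>, and the bound on \<open>w\<close> turns the
    remainder into a multiple of \<open>u - v\<close>.\<close>
  show ?thesis
    using 1 2 3 4 5 6 G(3) v by (simp add: algebra_simps)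
qed

text \<open>The pair \<open>(D, d)\<close> is a recession direction at fixed \<open>w\<close>: it
  satisfies the homogeneous versions of all constraints. Solutions of the same value thus exist
  arbitrarily far out.\<close>

lemma aux_feasible_add_recession:
  assumes "aux_feasible A b C X y w" and "psd D" "nonneg_vec d" "0 \<le> l"
    and "\<And>i. 0 \<le> trace_inner (A i) D" "psd (- lin_comb A d)" "trace_inner C D \<le> b \<bullet> d"
  shows "aux_feasible A b C (X + l *\<^sub>R D) (y + l *\<^sub>R d) w"
proof -
  have "psd (C - (lin_comb A y - mat w) + l *\<^sub>R - lin_comb A d)"
    using assms(1) by (intro psd_add psd_scaleR assms) (simp add: aux_feasible_def loewner_le_def)
  also have "C - (lin_comb A y - mat w) + l *\<^sub>R - lin_comb A d =
      C - (lin_comb A (y + l *\<^sub>R d) - mat w)"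
    by (simp add: lin_comb_add lin_comb_scaleR)
  finally have "lin_comb A (y + l *\<^sub>R d) - mat w \<preceq>\<^sub>L C" by (simp add: loewner_le_def)
  moreover have "b $ i \<le> trace_inner (A i) (X + l *\<^sub>R D) + w" for i
  proof -
    have "b $ i \<le> trace_inner (A i) X + w" using assms(1) by (simp add: aux_feasible_def)
    moreover have "0 \<le> l * trace_inner (A i) D" by (intro mult_nonneg_nonneg assms)
    ultimately show ?thesis by (simp add: trace_inner_simps)
  qed
  moreover have "trace_inner C (X + l *\<^sub>R D) - b \<bullet> (y + l *\<^sub>R d) - w \<le> 0"
  proof -
    have "trace_inner C X - b \<bullet> y - w \<le> 0" using assms(1) by (simp add: aux_feasible_def)
    moreover have "l * trace_inner C D \<le> l * (b \<bullet> d)" by (intro mult_left_mono assms)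
    ultimately show ?thesis by (simp add: trace_inner_simps inner_add_right)
  qed
  moreover have "psd (X + l *\<^sub>R D)"
    using assms(1) by (intro psd_add psd_scaleR assms) (simp add: aux_feasible_def)
  moreover have "nonneg_vec (y + l *\<^sub>R d)" "0 \<le> w"
    using assms by (simp_all add: aux_feasible_def nonneg_vec_def)
  ultimately show ?thesis unfolding aux_feasible_def by blast
qed

section \<open>Unbounded directions and infeasibility\<close>

lemma primal_unbounded_dir_infeasible:
  assumes "primal_unbounded_dir A C W"
  shows "\<not> dual_feasible A C y"
proof
  assume "dual_feasible A C y"
  then have y: "nonneg_vec y" "psd (C - lin_comb A y)"
    by (simp_all add: dual_feasible_def loewner_le_def)
  have W: "psd W" "\<And>i. 0 \<le> trace_inner (A i) W" "trace_inner C W < 0"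
    using assms by (simp_all add: primal_unbounded_dir_def)
  have "0 \<le> trace_inner (C - lin_comb A y) W"
    by (rule psd_trace_inner_nonneg[OF y(2) W(1)])
  moreover have "0 \<le> trace_inner (lin_comb A y) W"
    unfolding trace_inner_lin_comb using y(1) W(2)
    by (intro sum_nonneg mult_nonneg_nonneg) (auto simp: nonneg_vec_def)
  ultimately show False using W(3) by (simp add: trace_inner_diff_left)
qed

lemma dual_unbounded_dir_infeasible:
  assumes "dual_unbounded_dir A b d"
  shows "\<not> primal_feasible A b X"
proof
  assume "primal_feasible A b X"
  then have X: "psd X" "\<And>i. b $ i \<le> trace_inner (A i) X"
    by (simp_all add: primal_feasible_def)
  have d: "nonneg_vec d" "psd (- lin_comb A d)" "0 < b \<bullet> d"
    using assms by (simp_all add: dual_unbounded_dir_def loewner_le_def)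
  have "0 \<le> trace_inner (- lin_comb A d) X"
    by (rule psd_trace_inner_nonneg[OF d(2) X(1)])
  moreover have "b \<bullet> d \<le> trace_inner (lin_comb A d) X"
    unfolding trace_inner_lin_comb inner_commute[of b d] unfolding inner_vec_def inner_real_def
    using d(1) X(2) by (intro sum_mono mult_left_mono) (auto simp: nonneg_vec_def)
  ultimately show False using d(3) by (simp add: trace_inner_minus_left)
qed

text \<open>Merges the two cases of the hypothesis by setting the other component to zero. The
  positive total weight allows scaling to any prescribed size, and weak duality excludes
  simultaneous feasibility.\<close>

lemma strictly_unbounded_dir_recession:
  assumes "(\<exists>W. primal_strictly_unbounded_dir A C W) \<or> (\<exists>y. dual_strictly_unbounded_dir A b y)"
  obtains D d where "psd D" "nonneg_vec d" "\<And>i. 0 \<le> trace_inner (A i) D" "psd (- lin_comb A d)"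
    "trace_inner C D \<le> b \<bullet> d" "0 < trace D + (\<Sum>i\<in>UNIV. d $ i)"
    "\<And>X y. primal_feasible A b X \<Longrightarrow> \<not> dual_feasible A C y"
  using assms
proof
  assume "\<exists>W. primal_strictly_unbounded_dir A C W"
  then obtain W where W: "psd W" "\<And>i. 0 < trace_inner (A i) W" "trace_inner C W < 0"
    by (auto simp: primal_strictly_unbounded_dir_def)
  have "trace W \<noteq> 0"
  proof
    assume "trace W = 0"
    then have "W = 0" using psd_norm_le_trace[OF W(1)] by simp
    then show False using W(3) by (simp add: trace_inner_zero_right)
  qed
  then have "0 < trace W" using psd_trace_nonneg[OF W(1)] by simp
  moreover have "primal_unbounded_dir A C W"
    using W by (simp add: primal_unbounded_dir_def less_imp_le)
  ultimately show ?thesis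
    using W by (intro that[of W 0])
      (auto simp: lin_comb_zero psd_zero nonneg_vec_def less_imp_le dest: primal_unbounded_dir_infeasible)
next
  assume "\<exists>y. dual_strictly_unbounded_dir A b y"
  then obtain d where d: "nonneg_vec d" "pd (- lin_comb A d)" "0 < b \<bullet> d"
    by (auto simp: dual_strictly_unbounded_dir_def loewner_less_def)
  have psd: "psd (- lin_comb A d)"
    unfolding psd_def
  proof (intro conjI allI)
    show "sym_mat (- lin_comb A d)" using d(2) by (simp add: pd_def)
    show "0 \<le> z \<bullet> (- lin_comb A d *v z)" for z
      using d(2) by (cases "z = 0") (simp_all add: pd_def less_imp_le)
  qed
  have nn: "0 \<le> d $ i" for i using d(1) by (simp add: nonneg_vec_def)
  have "(\<Sum>i\<in>UNIV. d $ i) \<noteq> 0"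
  proof
    assume "(\<Sum>i\<in>UNIV. d $ i) = 0"
    then have "d = 0" using nn by (simp add: sum_nonneg_eq_0_iff vec_eq_iff)
    then show False using d(3) by simp
  qed
  then have "0 < (\<Sum>i\<in>UNIV. d $ i)" using nn by (simp add: sum_nonneg order_less_le)
  moreover have "dual_unbounded_dir A b d"
    using d psd by (simp add: dual_unbounded_dir_def loewner_le_def)
  ultimately show ?thesis
    using d psd by (intro that[of 0 d])
      (auto simp: trace_inner_zero_right trace_zero psd_zero dest: dual_unbounded_dir_infeasible)
qed

theorem theorem3p10:
  fixes A :: "'m::finite \<Rightarrow> real^'n::finite^'n"
    and C :: "real^'n^'n"
    and b :: "real^'m"
    and M v :: real
  assumes "\<And>i. sym_mat (A i)"
    and "sym_mat C"
    and "solution_bound A b C M"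
    and "v = dantzig_value A b C M"
    and "(\<exists>W. primal_strictly_unbounded_dir A C W) \<or> (\<exists>y. dual_strictly_unbounded_dir A b y)"
  shows "\<forall>X' y' t' u. dantzig_optimal1 A b C M (diag1 X' y' t' u) \<longrightarrow>
           t' = 0 \<and> u = v \<and>
           (primal_unbounded_dir A C X' \<and> \<not> (\<exists>y. dual_feasible A C y) \<or>
            dual_unbounded_dir A b y' \<and> \<not> (\<exists>X. primal_feasible A b X))"
proof (intro allI impI)
  fix X y t u
  assume opt: "dantzig_optimal1 A b C M (diag1 X y t u)"
  note G = dantzig_optimal1D[OF opt assms(1,2,4)]
  have "\<exists>X y w. aux_optimal A b C X y w"
    using assms(5) aux_attained_primal[OF assms(2)] aux_attained_dual[OF assms(2)] by blast
  then obtain X0 y0 w where aux: "aux_optimal A b C X0 y0 w"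
    and M: "0 < M" "trace X0 + (\<Sum>i\<in>UNIV. y0 $ i) + 1 \<le> M"
    using assms(3) unfolding solution_bound_def by blast
  have feas: "aux_feasible A b C X0 y0 w" using aux by (simp add: aux_optimal_def)
  obtain D d where D: "psd D" "nonneg_vec d" "\<And>i. 0 \<le> trace_inner (A i) D" "psd (- lin_comb A d)"
    "trace_inner C D \<le> b \<bullet> d" and tr: "0 < trace D + (\<Sum>i\<in>UNIV. d $ i)"
    and infeas: "\<And>X y. primal_feasible A b X \<Longrightarrow> \<not> dual_feasible A C y"
    by (rule strictly_unbounded_dir_recession[OF assms(5)]) blast
  \<comment> \<open>At value 0, the auxiliary constraints would make \<open>X0\<close> and
    \<open>y0\<close> feasible for the two programs at once.\<close>
  have "w \<noteq> 0"
  proof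
    assume "w = 0"
    then have "primal_feasible A b X0" "dual_feasible A C y0"
      using feas by (simp_all add: aux_feasible_def primal_feasible_def dual_feasible_def)
    then show False using infeas by blast
  qed
  then have w: "0 < w" using feas by (simp add: aux_feasible_def)
  have "w / (1 + M + w) \<le> v"
    unfolding assms(4) using M(1) by (intro dantzig_value_ge_aux[OF aux w _ assms(1,2)]) simp
  then have vw: "w \<le> v * (1 + M + w)" using w M(1) by (simp add: pos_divide_le_eq)
  have v: "0 < v"
    using \<open>w / (1 + M + w) \<le> v\<close> w M(1) by (smt (verit) divide_pos_pos)
  \<comment> \<open>This is evaluated at two auxiliary solutions of the same value \<open>w\<close>,
    for which the second factor has opposite signs.\<close>
  note ineq = optimal_against_aux_feasible[OF G(1-3,5-8) _ vw]
  have "u = v"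
  proof (rule antisym)
    from ineq[OF feas] M(2) w have "0 \<le> (u - v) * (trace X0 + (\<Sum>i\<in>UNIV. y0 $ i) - (M + w))" by simp
    moreover have "trace X0 + (\<Sum>i\<in>UNIV. y0 $ i) - (M + w) < 0" using M(2) w by simp
    ultimately show "u \<le> v" by (simp add: zero_le_mult_iff)
  next
    define k where "k = trace X0 + (\<Sum>i\<in>UNIV. y0 $ i) - (M + w)"
    define e where "e = trace D + (\<Sum>i\<in>UNIV. d $ i)"
    \<comment> \<open>Chosen so that moving by \<open>l\<close> along \<open>(D, d)\<close> raises
      the second factor from \<open>k < 0\<close> to exactly 1.\<close>
    define l where "l = (1 - k) / e"
    have "k < 0" using M(2) w by (simp add: k_def)
    then have l: "0 \<le> l" and kl: "k + l * e = 1" using tr by (simp_all add: l_def e_def)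
    have "trace (X0 + l *\<^sub>R D) = trace X0 + l * trace D"
      by (simp add: trace_def sum.distrib sum_distrib_left)
    moreover have "(\<Sum>i\<in>UNIV. (y0 + l *\<^sub>R d) $ i) = (\<Sum>i\<in>UNIV. y0 $ i) + l * (\<Sum>i\<in>UNIV. d $ i)"
      by (simp add: sum.distrib sum_distrib_left)
    ultimately have "trace (X0 + l *\<^sub>R D) + (\<Sum>i\<in>UNIV. (y0 + l *\<^sub>R d) $ i) - (M + w) = 1"
      using kl by (simp add: k_def e_def algebra_simps)
    with ineq[OF aux_feasible_add_recession[OF feas D(1,2) l D(3-5)]] show "v \<le> u" by simp
  qed
  have psd: "psd (t *\<^sub>R C - lin_comb A y)" using G(6) \<open>u = v\<close> by simp
  have AX: "t * b $ i \<le> trace_inner (A i) X" for i using G(7)[of i] \<open>u = v\<close> by simp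
  \<comment> \<open>With \<open>u = v\<close>, the guarantee on the scalar block leaves a gap of at
    least \<open>v + v * M\<close>, which is positive.\<close>
  have gap: "0 < b \<bullet> y - trace_inner C X"
    using G(8) v mult_pos_pos[OF v M(1)] unfolding \<open>u = v\<close> by linarith
  \<comment> \<open>Weak duality for the homogenised pair: both objectives are compared, after
    scaling by \<open>t\<close>, with the pairing of \<open>lin_comb A y\<close> and
    \<open>X\<close>. Together with the positive gap this forces \<open>t = 0\<close>.\<close>
  have "t * (b \<bullet> y - trace_inner C X) \<le> 0"
  proof -
    have "t * (b \<bullet> y) = (\<Sum>i\<in>UNIV. y $ i * (t * b $ i))"
      by (simp add: inner_vec_def sum_distrib_left mult_ac)
    also have "\<dots> \<le> trace_inner (lin_comb A y) X"
      unfolding trace_inner_lin_comb using G(2) AX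
      by (intro sum_mono mult_left_mono) (auto simp: nonneg_vec_def)
    also have "\<dots> \<le> t * trace_inner C X"
      using psd_trace_inner_nonneg[OF psd G(1)]
      by (simp add: trace_inner_diff_left trace_inner_scaleR_left)
    finally show ?thesis by (simp add: right_diff_distrib)
  qed
  then have t: "t = 0" using gap G(3) by (simp add: mult_le_0_iff)
  \<comment> \<open>At \<open>t = 0\<close> the homogenised constraints are those of the two kinds
    of direction, and a positive gap requires a negative \<open>trace_inner C X\<close> or a
    positive \<open>b \<bullet> y\<close>.\<close>
  have "primal_unbounded_dir A C X \<or> dual_unbounded_dir A b y"
    using gap AX psd G(1,2)
    by (auto simp: t primal_unbounded_dir_def dual_unbounded_dir_def loewner_le_def)
  then show "t = 0 \<and> u = v \<and>
      (primal_unbounded_dir A C X \<and> \<not> (\<exists>y. dual_feasible A C y) \<or>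
       dual_unbounded_dir A b y \<and> \<not> (\<exists>X. primal_feasible A b X))"
    using t \<open>u = v\<close> primal_unbounded_dir_infeasible dual_unbounded_dir_infeasible by blast
qed

end
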